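(* Let $K$ be a field of characteristic $p>0$, let $S=K[\![x_1,\ldots,x_n]\!]$ be the formal power series ring, let $\Delta$ be a simplicial complex with vertex set $[n]=\{1,\ldots,n\}$, let $I_\Delta\subset S$ be its Stanley-Reisner ideal, and let $R:=S/I_\Delta$. Assume that each variable $x_i$ ($1\le i\le n$) divides some minimal monomial generator of $I_\Delta$. Then the following are equivalent: (a) The Cartier algebra $\mathcal{C}(R)$ is principally generated. (b) $\Delta$ does not have a free face, that is, one cannot apply an elementary collapse to $\Delta$.
   Context: A simplicial complex $\Delta$ with vertex set $[n]$ is a nonempty family of subsets of $[n]$ (called faces) closed under taking subsets. Its Stanley-Reisner ideal is the squarefree monomial ideal $I_\Delta:=\left(\prod_{i\in F}x_i \mid F\subset[n],\ F\notin\Delta\right)\subset S$. A facet of $\Delta$ is a maximal face with respect to inclusion. A face $F\in\Delta$ is a free face if there is some $i\notin F$ such that $F\cup\{i\}$ is a facet of $\Delta$ and $F\cup\{i\}$ is the unique facet of $\Delta$ containing $F$. In that situation, passing from $\Delta$ to $\Delta\setminus\{F,F\cup\{i\}\}$ is called an elementary collapse. For a complete local ring $R$ of characteristic $p>0$, $F^e_*R$ denotes $R$ regarded as a left $R$-module via the $e$-th iterated Frobenius map, i.e. $r\cdot m:=r^{p^e}m$. The Cartier algebra of $R$ is the graded, associative, not necessarily commutative ring $\mathcal{C}(R):=\bigoplus_{e\ge 0}\operatorname{Hom}_R(F^e_*R,R)$, where the product of $\varphi\in\operatorname{Hom}_R(F^e_*R,R)$ and $\psi\in\operatorname{Hom}_R(F^{e'}_*R,R)$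 is the composition $\varphi\circ F^e_*\psi\in\operatorname{Hom}_R(F^{e+e'}_*R,R)$ (as a map of sets, $\varphi\circ\psi$). Its degree $0$ part is $\operatorname{Hom}_R(R,R)=R$. It is called principally generated if it is generated as an $R$-algebra by one element, i.e. there is $\varphi\in\mathcal{C}(R)$ such that $\mathcal{C}(R)$ is generated as a ring by its degree $0$ part $R$ together with $\varphi$.
   Formalization: The field K is additionally assumed F-finite ([K:K^p] finite); without this the claim fails, e.g. for Δ={∅}, where R=K has no free face but C(K) is not principally generated. *)

theory Defs
  imports
    "HOL-Algebra.QuotRing" "HOL-Algebra.Divisibility" "HOL-Algebra.Generated_Rings"
    "HOL-Library.Poly_Mapping"
    "HOL-Computational_Algebra.Primes"
begin

section \<open>Formal power series in finitely many variables\<close>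

text \<open>
  Monomials in variables indexed by natural numbers are exponent vectors
  \<^typ>\<open>nat \<Rightarrow>\<^sub>0 nat\<close>; a power series is its family of coefficients.  The ring of power
  series in the variables \<open>x\<^sub>i\<close>, \<open>i \<in> V\<close>, consists of the families supported on the
  monomials in these variables, with the Cauchy product.
\<close>

definition pseries_ring :: "nat set \<Rightarrow> ((nat \<Rightarrow>\<^sub>0 nat) \<Rightarrow> 'k::comm_ring_1) ring" where
  "pseries_ring V =
    \<lparr>carrier = {f. \<forall>m. f m \<noteq> 0 \<longrightarrow> Poly_Mapping.keys m \<subseteq> V},
     mult = (\<lambda>f g m. \<Sum>(a, b) | a + b = m. f a * g b),
     one = (\<lambda>m. if m = 0 then 1 else 0),
     zero = (\<lambda>m. 0),
     add = (\<lambda>f g m. f m + g m)\<rparr>"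

definition pseries_monom :: "(nat \<Rightarrow>\<^sub>0 nat) \<Rightarrow> (nat \<Rightarrow>\<^sub>0 nat) \<Rightarrow> 'k::comm_ring_1" where
  "pseries_monom m = (\<lambda>m'. if m' = m then 1 else 0)"

definition pseries_var :: "nat \<Rightarrow> (nat \<Rightarrow>\<^sub>0 nat) \<Rightarrow> 'k::comm_ring_1" where
  "pseries_var i = pseries_monom (Poly_Mapping.single i 1)"

lemma finite_monom_splits: "finite {(a, b). a + b = (m :: nat \<Rightarrow>\<^sub>0 nat)}"
proof -
  let ?D = "{a. \<exists>b. a + b = m}"
  let ?A = "Poly_Mapping.keys m"
  let ?F = "{f. \<forall>i. (i \<in> ?A \<longrightarrow> f i \<in> (\<Union>j\<in>?A. {..Poly_Mapping.lookup m j})) \<and> (i \<notin> ?A \<longrightarrow> f i = (0::nat))}"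
  have "finite ?F"
    by (rule finite_set_of_finite_funs) auto
  moreover have "Poly_Mapping.lookup ` ?D \<subseteq> ?F"
    by (fastforce simp: lookup_add in_keys_iff)
  ultimately have "finite (Poly_Mapping.lookup ` ?D)"
    by (rule rev_finite_subset)
  then have D: "finite ?D"
    by (rule finite_imageD) (simp add: inj_on_def)
  have "{(a, b). a + b = m} \<subseteq> (\<lambda>a. (a, m - a)) ` ?D"
    by (auto simp: image_iff)
  with D show ?thesis
    by (meson finite_imageI finite_subset)
qed

lemma keys_add_nat: "Poly_Mapping.keys (a + b) = Poly_Mapping.keys a \<union> Poly_Mapping.keys (b :: nat \<Rightarrow>\<^sub>0 nat)"
  by (auto simp: in_keys_iff lookup_add)

lemma pseries_mult_assoc:
  fixes f g h :: "(nat \<Rightarrow>\<^sub>0 nat) \<Rightarrow> 'k::comm_ring_1"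
  shows "(\<Sum>(a, b) | a + b = m. (\<Sum>(c, d) | c + d = a. f c * g d) * h b) =
         (\<Sum>(a, b) | a + b = m. f a * (\<Sum>(c, d) | c + d = b. g c * h d))"
proof -
  have "(\<Sum>(a, b) | a + b = m. (\<Sum>(c, d) | c + d = a. f c * g d) * h b) =
    (\<Sum>x\<in>{(a, b). a + b = m}. \<Sum>y\<in>{(c, d). c + d = fst x}. f (fst y) * g (snd y) * h (snd x))"
    by (simp add: case_prod_unfold sum_distrib_right)
  also have "\<dots> = (\<Sum>(x, y)\<in>(SIGMA x:{(a, b). a + b = m}. {(c, d). c + d = fst x}).
      f (fst y) * g (snd y) * h (snd x))"
    by (rule sum.Sigma) (auto simp: finite_monom_splits)
  also have "\<dots> = (\<Sum>(x, y)\<in>(SIGMA x:{(a, b). a + b = m}. {(c, d). c + d = snd x}).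
      f (fst x) * (g (fst y) * h (snd y)))"
    by (rule sum.reindex_bij_witness
          [where i = "\<lambda>(x, y). ((fst x + fst y, snd y), (fst x, fst y))"
             and j = "\<lambda>(x, y). ((fst y, snd y + snd x), (snd y, snd x))"])
       (auto simp: ac_simps)
  also have "\<dots> = (\<Sum>x\<in>{(a, b). a + b = m}. \<Sum>y\<in>{(c, d). c + d = snd x}.
      f (fst x) * (g (fst y) * h (snd y)))"
    by (rule sum.Sigma[symmetric]) (auto simp: finite_monom_splits)
  also have "\<dots> = (\<Sum>(a, b) | a + b = m. f a * (\<Sum>(c, d) | c + d = b. g c * h d))"
    by (simp add: case_prod_unfold sum_distrib_left)
  finally show ?thesis .
qed

lemma pseries_mult_one:
  fixes f :: "(nat \<Rightarrow>\<^sub>0 nat) \<Rightarrow> 'k::comm_ring_1"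
  shows "(\<Sum>(a :: nat \<Rightarrow>\<^sub>0 nat, b) | a + b = m. (if a = 0 then 1 else 0) * f b) = f m"
proof -
  have "(\<Sum>(a :: nat \<Rightarrow>\<^sub>0 nat, b) | a + b = m. (if a = 0 then 1 else 0) * f b) =
        (\<Sum>(a, b) \<in> {(0 :: nat \<Rightarrow>\<^sub>0 nat, m)}. (if a = 0 then 1 else 0) * f b)"
    by (rule sum.mono_neutral_right[OF finite_monom_splits]) (auto split: if_splits)
  then show ?thesis by simp
qed

lemma pseries_mult_commute:
  fixes f :: "(nat \<Rightarrow>\<^sub>0 nat) \<Rightarrow> 'k::comm_ring_1"
  shows "(\<Sum>(a, b) | a + b = m. f a * g b) = (\<Sum>(a, b) | a + b = m. g a * f b)"
  by (rule sum.reindex_bij_witness[where i = "\<lambda>(a, b). (b, a)" and j = "\<lambda>(a, b). (b, a)"])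
     (auto simp: ac_simps)

lemma pseries_ring_cring: "cring (pseries_ring V :: ((nat \<Rightarrow>\<^sub>0 nat) \<Rightarrow> 'k::comm_ring_1) ring)"
proof (rule cringI)
  show "abelian_group (pseries_ring V :: ((nat \<Rightarrow>\<^sub>0 nat) \<Rightarrow> 'k) ring)"
  proof (rule abelian_groupI)
    fix x :: "(nat \<Rightarrow>\<^sub>0 nat) \<Rightarrow> 'k" assume "x \<in> carrier (pseries_ring V)"
    then show "\<exists>y\<in>carrier (pseries_ring V). y \<oplus>\<^bsub>pseries_ring V\<^esub> x = \<zero>\<^bsub>pseries_ring V\<^esub>"
      by (intro bexI[of _ "\<lambda>m. - x m"]) (auto simp: pseries_ring_def)
  qed (auto simp: pseries_ring_def algebra_simps, force)
  have closed: "x \<otimes>\<^bsub>pseries_ring V\<^esub> y \<in> carrier (pseries_ring V)"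
    if "x \<in> carrier (pseries_ring V)" "y \<in> carrier (pseries_ring V)"
    for x y :: "(nat \<Rightarrow>\<^sub>0 nat) \<Rightarrow> 'k"
  proof -
    have "Poly_Mapping.keys m \<subseteq> V" if "(\<Sum>(a, b) | a + b = m. x a * y b) \<noteq> 0" for m
    proof -
      from that obtain a b where "a + b = m" "x a * y b \<noteq> 0"
        by (auto elim!: sum.not_neutral_contains_not_neutral)
      with \<open>x \<in> _\<close> \<open>y \<in> _\<close> show ?thesis
        by (auto simp: pseries_ring_def keys_add_nat) (metis mult_zero_left mult_zero_right subsetD)+
    qed
    then show ?thesis by (auto simp: pseries_ring_def)
  qed
  show "Group.comm_monoid (pseries_ring V :: ((nat \<Rightarrow>\<^sub>0 nat) \<Rightarrow> 'k) ring)"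
  proof (rule comm_monoidI)
    fix x y z :: "(nat \<Rightarrow>\<^sub>0 nat) \<Rightarrow> 'k"
    assume "x \<in> carrier (pseries_ring V)" "y \<in> carrier (pseries_ring V)"
    then show "x \<otimes>\<^bsub>pseries_ring V\<^esub> y \<in> carrier (pseries_ring V)"
      by (rule closed)
    show "x \<otimes>\<^bsub>pseries_ring V\<^esub> y = y \<otimes>\<^bsub>pseries_ring V\<^esub> x"
      by (simp add: pseries_ring_def pseries_mult_commute[of x y])
    show "x \<otimes>\<^bsub>pseries_ring V\<^esub> y \<otimes>\<^bsub>pseries_ring V\<^esub> z =
          x \<otimes>\<^bsub>pseries_ring V\<^esub> (y \<otimes>\<^bsub>pseries_ring V\<^esub> z)"
      by (simp add: pseries_ring_def pseries_mult_assoc)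
    show "\<one>\<^bsub>pseries_ring V\<^esub> \<otimes>\<^bsub>pseries_ring V\<^esub> x = x"
      by (simp add: pseries_ring_def pseries_mult_one)
  qed (auto simp: pseries_ring_def)
  fix x y z :: "(nat \<Rightarrow>\<^sub>0 nat) \<Rightarrow> 'k"
  show "(x \<oplus>\<^bsub>pseries_ring V\<^esub> y) \<otimes>\<^bsub>pseries_ring V\<^esub> z =
        x \<otimes>\<^bsub>pseries_ring V\<^esub> z \<oplus>\<^bsub>pseries_ring V\<^esub> y \<otimes>\<^bsub>pseries_ring V\<^esub> z"
    by (simp add: pseries_ring_def case_prod_unfold sum.distrib algebra_simps)
qed


section \<open>Minimal monomial generators\<close>

definition minimal_monomial_generators ::
  "((nat \<Rightarrow>\<^sub>0 nat) \<Rightarrow> 'k::comm_ring_1) ring \<Rightarrow> ((nat \<Rightarrow>\<^sub>0 nat) \<Rightarrow> 'k) set \<Rightarrow> ((nat \<Rightarrow>\<^sub>0 nat) \<Rightarrow> 'k) set \<Rightarrow> bool"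
where
  "minimal_monomial_generators S I G \<longleftrightarrow>
     G \<subseteq> carrier S \<inter> range pseries_monom \<and> Idl\<^bsub>S\<^esub> G = I \<and> (\<forall>H. H \<subset> G \<longrightarrow> Idl\<^bsub>S\<^esub> H \<noteq> I)"

text \<open>
  A monomial ideal has exactly one minimal set of monomial generators; its elements are
  the minimal monomial generators of the ideal.
\<close>

definition minimal_monomial_generator ::
  "((nat \<Rightarrow>\<^sub>0 nat) \<Rightarrow> 'k::comm_ring_1) ring \<Rightarrow> ((nat \<Rightarrow>\<^sub>0 nat) \<Rightarrow> 'k) set \<Rightarrow> ((nat \<Rightarrow>\<^sub>0 nat) \<Rightarrow> 'k) \<Rightarrow> bool"
where
  "minimal_monomial_generator S I u \<longleftrightarrow> (\<exists>G. minimal_monomial_generators S I G \<and> u \<in> G)"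


section \<open>Simplicial complexes and Stanley-Reisner ideals\<close>

text \<open>Not every element of \<open>{1..n}\<close> needs to be a face.\<close>

definition simplicial_complex_on :: "nat \<Rightarrow> nat set set \<Rightarrow> bool" where
  "simplicial_complex_on n \<Delta> \<longleftrightarrow>
     \<Delta> \<noteq> {} \<and> (\<forall>F\<in>\<Delta>. F \<subseteq> {1..n}) \<and> (\<forall>F\<in>\<Delta>. \<forall>G. G \<subseteq> F \<longrightarrow> G \<in> \<Delta>)"

definition facet :: "'v set set \<Rightarrow> 'v set \<Rightarrow> bool" where
  "facet \<Delta> F \<longleftrightarrow> F \<in> \<Delta> \<and> (\<forall>G\<in>\<Delta>. F \<subseteq> G \<longrightarrow> G = F)"

definition free_face_at :: "'v set set \<Rightarrow> 'v set \<Rightarrow> 'v \<Rightarrow> bool" where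
  "free_face_at \<Delta> F i \<longleftrightarrow>
     F \<in> \<Delta> \<and> i \<notin> F \<and> facet \<Delta> (F \<union> {i}) \<and> (\<forall>G. facet \<Delta> G \<and> F \<subseteq> G \<longrightarrow> G = F \<union> {i})"

definition free_face :: "'v set set \<Rightarrow> 'v set \<Rightarrow> bool" where
  "free_face \<Delta> F \<longleftrightarrow> (\<exists>i. free_face_at \<Delta> F i)"

definition elementary_collapse :: "'v set set \<Rightarrow> 'v set set \<Rightarrow> bool" where
  "elementary_collapse \<Delta> \<Delta>' \<longleftrightarrow> (\<exists>F i. free_face_at \<Delta> F i \<and> \<Delta>' = \<Delta> - {F, F \<union> {i}})"

lemma free_face_iff_elementary_collapse:
  "(\<exists>F. free_face \<Delta> F) \<longleftrightarrow> (\<exists>\<Delta>'. elementary_collapse \<Delta> \<Delta>')"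
  by (auto simp: free_face_def elementary_collapse_def)

definition stanley_reisner_ideal :: "nat \<Rightarrow> nat set set \<Rightarrow> ((nat \<Rightarrow>\<^sub>0 nat) \<Rightarrow> 'k::comm_ring_1) set" where
  "stanley_reisner_ideal n \<Delta> =
     Idl\<^bsub>pseries_ring {1..n}\<^esub>
       {\<Otimes>\<^bsub>pseries_ring {1..n}\<^esub> i\<in>F. pseries_var i | F. F \<subseteq> {1..n} \<and> F \<notin> \<Delta>}"


section \<open>The Cartier algebra\<close>

definition ring_as_module :: "('a, 'r) ring_scheme \<Rightarrow> ('a, 'a) module" where
  "ring_as_module R =
     \<lparr>carrier = carrier R, mult = mult R, one = one R, zero = zero R, add = add R,
      smult = (\<lambda>r m. r \<otimes>\<^bsub>R\<^esub> m)\<rparr>"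

text \<open>\<open>F\<^sup>e\<^sub>*R\<close>, which is an \<open>R\<close>-module if \<open>R\<close> has characteristic \<open>p\<close>.\<close>

definition frobenius_module :: "nat \<Rightarrow> nat \<Rightarrow> ('a, 'r) ring_scheme \<Rightarrow> ('a, 'a) module" where
  "frobenius_module p e R =
     \<lparr>carrier = carrier R, mult = mult R, one = one R, zero = zero R, add = add R,
      smult = (\<lambda>r m. (r [^]\<^bsub>R\<^esub> (p ^ e)) \<otimes>\<^bsub>R\<^esub> m)\<rparr>"

definition module_hom :: "('a, 'r) ring_scheme \<Rightarrow> ('a, 'b) module \<Rightarrow> ('a, 'c) module \<Rightarrow> ('b \<Rightarrow> 'c) set" where
  "module_hom R M N =
     {\<phi> \<in> carrier M \<rightarrow>\<^sub>E carrier N.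
        (\<forall>x\<in>carrier M. \<forall>y\<in>carrier M. \<phi> (x \<oplus>\<^bsub>M\<^esub> y) = \<phi> x \<oplus>\<^bsub>N\<^esub> \<phi> y) \<and>
        (\<forall>r\<in>carrier R. \<forall>x\<in>carrier M. \<phi> (r \<odot>\<^bsub>M\<^esub> x) = r \<odot>\<^bsub>N\<^esub> \<phi> x)}"

definition cartier_hom :: "nat \<Rightarrow> nat \<Rightarrow> ('a, 'r) ring_scheme \<Rightarrow> ('a \<Rightarrow> 'a) set" where
  "cartier_hom p e R = module_hom R (frobenius_module p e R) (ring_as_module R)"

definition zero_map :: "('a, 'r) ring_scheme \<Rightarrow> 'a \<Rightarrow> 'a" where
  "zero_map R = (\<lambda>x\<in>carrier R. \<zero>\<^bsub>R\<^esub>)"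

text \<open>
  An element of the direct sum is the family \<open>\<Phi>\<close> of its homogeneous components, \<open>\<Phi> e\<close>
  being the one of degree \<open>e\<close>.  Since \<open>F\<^sup>e\<^sub>*\<psi>\<close> is \<open>\<psi>\<close> as a map of sets, the degree \<open>g\<close>
  component of a product is the sum of the \<open>\<Phi> e \<circ> \<Psi> (g - e)\<close>.
\<close>

definition cartier_algebra :: "nat \<Rightarrow> ('a, 'r) ring_scheme \<Rightarrow> (nat \<Rightarrow> 'a \<Rightarrow> 'a) ring" where
  "cartier_algebra p R =
     \<lparr>carrier = {\<Phi>. (\<forall>e. \<Phi> e \<in> cartier_hom p e R) \<and> finite {e. \<Phi> e \<noteq> zero_map R}},
      mult = (\<lambda>\<Phi> \<Psi> g. \<lambda>x\<in>carrier R. \<Oplus>\<^bsub>R\<^esub> e\<in>{..g}. \<Phi> e (\<Psi> (g - e) x)),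
      one = (\<lambda>e. if e = 0 then (\<lambda>x\<in>carrier R. x) else zero_map R),
      zero = (\<lambda>e. zero_map R),
      add = (\<lambda>\<Phi> \<Psi> e. \<lambda>x\<in>carrier R. \<Phi> e x \<oplus>\<^bsub>R\<^esub> \<Psi> e x)\<rparr>"

lemma cartier_hom_iff:
  "\<phi> \<in> cartier_hom p e R \<longleftrightarrow>
     \<phi> \<in> carrier R \<rightarrow>\<^sub>E carrier R \<and>
     (\<forall>x\<in>carrier R. \<forall>y\<in>carrier R. \<phi> (x \<oplus>\<^bsub>R\<^esub> y) = \<phi> x \<oplus>\<^bsub>R\<^esub> \<phi> y) \<and>
     (\<forall>r\<in>carrier R. \<forall>x\<in>carrier R. \<phi> ((r [^]\<^bsub>R\<^esub> (p ^ e)) \<otimes>\<^bsub>R\<^esub> x) = r \<otimes>\<^bsub>R\<^esub> \<phi> x)"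
  by (auto simp: cartier_hom_def module_hom_def frobenius_module_def ring_as_module_def)

context cring
begin

lemma cartier_hom_closed: "\<phi> \<in> cartier_hom p e R \<Longrightarrow> x \<in> carrier R \<Longrightarrow> \<phi> x \<in> carrier R"
  by (auto simp: cartier_hom_iff)

lemma cartier_hom_add:
  "\<phi> \<in> cartier_hom p e R \<Longrightarrow> x \<in> carrier R \<Longrightarrow> y \<in> carrier R \<Longrightarrow> \<phi> (x \<oplus> y) = \<phi> x \<oplus> \<phi> y"
  by (auto simp: cartier_hom_iff)

lemma cartier_hom_smult:
  "\<phi> \<in> cartier_hom p e R \<Longrightarrow> x \<in> carrier R \<Longrightarrow> r \<in> carrier R \<Longrightarrow>
   \<phi> ((r [^] (p ^ e)) \<otimes> x) = r \<otimes> \<phi> x"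
  by (auto simp: cartier_hom_iff)

lemma cartier_hom_zero: 
  assumes "\<phi> \<in> cartier_hom p e R" shows "\<phi> \<zero> = \<zero>"
  using cartier_hom_add[OF assms, of \<zero> \<zero>] cartier_hom_closed[OF assms, of \<zero>]
  by simp

lemma cartier_hom_finsum:
  assumes "\<phi> \<in> cartier_hom p e R" and "finite A" and "f \<in> A \<rightarrow> carrier R"
  shows "\<phi> (\<Oplus>i\<in>A. f i) = (\<Oplus>i\<in>A. \<phi> (f i))"
  using assms(2,3)
proof (induction A rule: finite_induct)
  case empty
  then show ?case using cartier_hom_zero[OF assms(1)] by simp
next
  case (insert a A)
  then have "f a \<in> carrier R" "f \<in> A \<rightarrow> carrier R" "(\<lambda>i. \<phi> (f i)) \<in> A \<rightarrow> carrier R"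
      "\<phi> (f a) \<in> carrier R" "(\<Oplus>i\<in>A. f i) \<in> carrier R"
    using cartier_hom_closed[OF assms(1)] by auto
  with insert show ?case using cartier_hom_add[OF assms(1)] by simp
qed

lemma zero_map_cartier_hom: "zero_map R \<in> cartier_hom p e R"
  by (auto simp: cartier_hom_iff zero_map_def)

lemma cartier_hom_plus:
  assumes "\<phi> \<in> cartier_hom p e R" "\<psi> \<in> cartier_hom p e R"
  shows "(\<lambda>x\<in>carrier R. \<phi> x \<oplus> \<psi> x) \<in> cartier_hom p e R"
proof -
  note c = cartier_hom_closed[OF assms(1)] cartier_hom_closed[OF assms(2)]
  note add = cartier_hom_add[OF assms(1)] cartier_hom_add[OF assms(2)]
  note smult = cartier_hom_smult[OF assms(1)] cartier_hom_smult[OF assms(2)]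
  have "\<phi> (x \<oplus> y) \<oplus> \<psi> (x \<oplus> y) = \<phi> x \<oplus> \<psi> x \<oplus> (\<phi> y \<oplus> \<psi> y)"
    if "x \<in> carrier R" "y \<in> carrier R" for x y
    using that by (simp add: add c a_ac)
  moreover have "\<phi> (r [^] (p ^ e) \<otimes> x) \<oplus> \<psi> (r [^] (p ^ e) \<otimes> x) = r \<otimes> (\<phi> x \<oplus> \<psi> x)"
    if "r \<in> carrier R" "x \<in> carrier R" for r x
    using that by (simp add: smult c r_distr)
  ultimately show ?thesis
    unfolding cartier_hom_iff by (auto simp: c)
qed

lemma cartier_hom_comp:
  assumes "\<phi> \<in> cartier_hom p e R" "\<psi> \<in> cartier_hom p e' R"
  shows "(\<lambda>x\<in>carrier R. \<phi> (\<psi> x)) \<in> cartier_hom p (e + e') R"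
proof -
  have "\<phi> (\<psi> (r [^] (p ^ (e + e')) \<otimes> x)) = r \<otimes> \<phi> (\<psi> x)"
    if "r \<in> carrier R" "x \<in> carrier R" for r x
  proof -
    have "r [^] (p ^ (e + e')) = (r [^] (p ^ e)) [^] (p ^ e')"
      using that by (simp add: nat_pow_pow power_add)
    then show ?thesis
      using that cartier_hom_smult[OF assms(2), of x "r [^] (p ^ e)"]
        cartier_hom_smult[OF assms(1), of "\<psi> x" r] cartier_hom_closed[OF assms(2)] by simp
  qed
  then show ?thesis
    using assms cartier_hom_closed[OF assms(1)] cartier_hom_closed[OF assms(2)]
    by (auto simp: cartier_hom_iff)
qed

lemma cartier_hom_sum:
  assumes "finite A" "\<And>i. i \<in> A \<Longrightarrow> f i \<in> cartier_hom p e R"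
  shows "(\<lambda>x\<in>carrier R. \<Oplus>i\<in>A. f i x) \<in> cartier_hom p e R"
  using assms
proof (induction A rule: finite_induct)
  case empty
  have "(\<lambda>x\<in>carrier R. \<Oplus>i\<in>{}. f i x) = zero_map R" by (simp add: zero_map_def)
  then show ?case using zero_map_cartier_hom by simp
next
  case (insert a A)
  have "(\<lambda>x\<in>carrier R. \<Oplus>i\<in>insert a A. f i x) =
        (\<lambda>x\<in>carrier R. f a x \<oplus> (\<lambda>x\<in>carrier R. \<Oplus>i\<in>A. f i x) x)"
  proof (rule restrict_ext)
    fix x assume x: "x \<in> carrier R"
    have "f i x \<in> carrier R" if "i \<in> insert a A" for i
      using cartier_hom_closed[OF insert.prems[OF that] x] .
    then have "(\<Oplus>i\<in>insert a A. f i x) = f a x \<oplus> (\<Oplus>i\<in>A. f i x)"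
      using insert.hyps by (intro finsum_insert) auto
    then show "(\<Oplus>i\<in>insert a A. f i x) = f a x \<oplus> (\<lambda>x\<in>carrier R. \<Oplus>i\<in>A. f i x) x"
      using x by simp
  qed
  moreover have "(\<lambda>x\<in>carrier R. \<Oplus>i\<in>A. f i x) \<in> cartier_hom p e R"
    by (rule insert.IH) (rule insert.prems, simp)
  moreover have "f a \<in> cartier_hom p e R"
    by (rule insert.prems) simp
  ultimately show ?case
    using cartier_hom_plus[of "f a" p e "\<lambda>x\<in>carrier R. \<Oplus>i\<in>A. f i x"] by (simp only:)
qed

lemma finsum_triangle:
  assumes "\<And>i j. h i j \<in> carrier R"
  shows "(\<Oplus>k\<in>{..g::nat}. \<Oplus>i\<in>{..k}. h i (k - i)) = (\<Oplus>i\<in>{..g}. \<Oplus>j\<in>{..g - i}. h i j)"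
proof (induction g)
  case 0
  then show ?case using assms by simp
next
  case (Suc g)
  have "(\<Oplus>i\<in>{..Suc g}. \<Oplus>j\<in>{..Suc g - i}. h i j) =
        h (Suc g) 0 \<oplus> (\<Oplus>i\<in>{..g}. h i (Suc g - i) \<oplus> (\<Oplus>j\<in>{..g - i}. h i j))"
  proof -
    have "(\<Oplus>i\<in>{..g}. \<Oplus>j\<in>{..Suc g - i}. h i j) = (\<Oplus>i\<in>{..g}. h i (Suc g - i) \<oplus> (\<Oplus>j\<in>{..g - i}. h i j))"
      using assms by (intro finsum_cong') (auto simp: Suc_diff_le)
    then show ?thesis using assms by simp
  qed
  also have "\<dots> = h (Suc g) 0 \<oplus> ((\<Oplus>i\<in>{..g}. h i (Suc g - i)) \<oplus> (\<Oplus>i\<in>{..g}. \<Oplus>j\<in>{..g - i}. h i j))"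
    using assms by (subst finsum_addf) auto
  also have "\<dots> = (\<Oplus>i\<in>{..Suc g}. h i (Suc g - i)) \<oplus> (\<Oplus>k\<in>{..g}. \<Oplus>i\<in>{..k}. h i (k - i))"
    using assms Suc by (simp add: a_assoc)
  finally show ?case using assms by simp
qed

lemma cartier_algebra_ring: "ring (cartier_algebra p R)"
proof (rule ringI)
  let ?C = "cartier_algebra p R"
  have homD: "\<Phi> e \<in> cartier_hom p e R" if "\<Phi> \<in> carrier ?C" for \<Phi> e
    using that by (simp add: cartier_algebra_def)
  note closed = cartier_hom_closed[OF homD]
  have ext: "\<Phi> = \<Psi>" if "\<And>e x. x \<in> carrier R \<Longrightarrow> \<Phi> e x = \<Psi> e x"
      "\<And>e. \<Phi> e \<in> extensional (carrier R)" "\<And>e. \<Psi> e \<in> extensional (carrier R)" for \<Phi> \<Psi>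
  proof (rule HOL.ext)
    show "\<Phi> e = \<Psi> e" for e
      using that by (intro extensionalityI[of _ "carrier R"]) auto
  qed
  have homE: "\<Phi> e \<in> extensional (carrier R)" if "\<Phi> \<in> carrier ?C" for \<Phi> e
    using homD[OF that, of e] by (auto simp: cartier_hom_iff PiE_def)
  have add_closed: "\<Phi> \<oplus>\<^bsub>?C\<^esub> \<Psi> \<in> carrier ?C" if "\<Phi> \<in> carrier ?C" "\<Psi> \<in> carrier ?C" for \<Phi> \<Psi>
  proof -
    have "{e. (\<lambda>x\<in>carrier R. \<Phi> e x \<oplus> \<Psi> e x) \<noteq> zero_map R} \<subseteq>
          {e. \<Phi> e \<noteq> zero_map R} \<union> {e. \<Psi> e \<noteq> zero_map R}"
      by (auto simp: zero_map_def)
    with that show ?thesis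
      by (auto simp: cartier_algebra_def intro!: cartier_hom_plus elim: finite_subset)
  qed
  have mult_closed: "\<Phi> \<otimes>\<^bsub>?C\<^esub> \<Psi> \<in> carrier ?C" if \<Phi>: "\<Phi> \<in> carrier ?C" and \<Psi>: "\<Psi> \<in> carrier ?C" for \<Phi> \<Psi>
  proof -
    let ?M = "\<lambda>g. \<lambda>x\<in>carrier R. \<Oplus>e\<in>{..g}. \<Phi> e (\<Psi> (g - e) x)"
    have "?M g \<in> cartier_hom p g R" for g
    proof -
      have "?M g = (\<lambda>x\<in>carrier R. \<Oplus>e\<in>{..g}. (\<lambda>x\<in>carrier R. \<Phi> e (\<Psi> (g - e) x)) x)"
        by (intro restrict_ext finsum_cong') (auto simp: closed that)
      moreover have "(\<lambda>x\<in>carrier R. \<Phi> e (\<Psi> (g - e) x)) \<in> cartier_hom p g R" if "e \<in> {..g}" for e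
        using cartier_hom_comp[OF homD[OF \<Phi>, of e] homD[OF \<Psi>, of "g - e"]] that by simp
      ultimately show ?thesis
        using cartier_hom_sum[of "{..g}" "\<lambda>e. \<lambda>x\<in>carrier R. \<Phi> e (\<Psi> (g - e) x)" p g] by simp
    qed
    moreover have "finite {g. ?M g \<noteq> zero_map R}"
    proof -
      let ?A = "{e. \<Phi> e \<noteq> zero_map R}" and ?B = "{e. \<Psi> e \<noteq> zero_map R}"
      have "g \<in> (\<lambda>(a, b). a + b) ` (?A \<times> ?B)" if "?M g \<noteq> zero_map R" for g
      proof (rule ccontr)
        assume *: "g \<notin> (\<lambda>(a, b). a + b) ` (?A \<times> ?B)"
        have "\<Phi> e (\<Psi> (g - e) x) = \<zero>" if "e \<le> g" "x \<in> carrier R" for e x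
        proof -
          have "\<Phi> e = zero_map R \<or> \<Psi> (g - e) = zero_map R"
            using * that(1) by (force simp: image_iff)
          then show ?thesis
            using that(2) closed[OF \<Psi>] cartier_hom_zero[OF homD[OF \<Phi>]] by (auto simp: zero_map_def)
        qed
        then have "(\<Oplus>e\<in>{..g}. \<Phi> e (\<Psi> (g - e) x)) = \<zero>" if "x \<in> carrier R" for x
          using that by (intro add.finprod_one_eqI) auto
        then have "?M g = zero_map R" by (auto simp: zero_map_def)
        with that show False by simp
      qed
      then have "{g. ?M g \<noteq> zero_map R} \<subseteq> (\<lambda>(a, b). a + b) ` (?A \<times> ?B)" by blast
      moreover have "finite ?A" "finite ?B" using \<Phi> \<Psi> by (auto simp: cartier_algebra_def)
      ultimately show ?thesis by (meson finite_SigmaI finite_imageI finite_subset)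
    qed
    ultimately show ?thesis by (simp add: cartier_algebra_def)
  qed
  have one_closed: "\<one>\<^bsub>?C\<^esub> \<in> carrier ?C"
  proof -
    have "{e. \<one>\<^bsub>?C\<^esub> e \<noteq> zero_map R} \<subseteq> {0}" by (auto simp: cartier_algebra_def)
    then have "finite {e. \<one>\<^bsub>?C\<^esub> e \<noteq> zero_map R}" by (rule finite_subset) simp
    moreover have "(\<lambda>x\<in>carrier R. x) \<in> cartier_hom p 0 R"
      by (auto simp: cartier_hom_iff)
    ultimately show ?thesis by (simp add: cartier_algebra_def zero_map_cartier_hom)
  qed
  show "abelian_group ?C"
  proof (rule abelian_groupI)
    fix \<Phi> \<Psi> assume "\<Phi> \<in> carrier ?C" "\<Psi> \<in> carrier ?C"
    then show "\<Phi> \<oplus>\<^bsub>?C\<^esub> \<Psi> \<in> carrier ?C" by (rule add_closed)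
  next
    show "\<zero>\<^bsub>?C\<^esub> \<in> carrier ?C" by (simp add: cartier_algebra_def zero_map_cartier_hom)
  next
    fix \<Phi> \<Psi> X assume "\<Phi> \<in> carrier ?C" "\<Psi> \<in> carrier ?C" "X \<in> carrier ?C"
    note c = closed[OF this(1)] closed[OF this(2)] closed[OF this(3)]
    show "\<Phi> \<oplus>\<^bsub>?C\<^esub> \<Psi> \<oplus>\<^bsub>?C\<^esub> X = \<Phi> \<oplus>\<^bsub>?C\<^esub> (\<Psi> \<oplus>\<^bsub>?C\<^esub> X)"
      by (rule ext) (simp_all add: cartier_algebra_def c a_assoc)
    show "\<Phi> \<oplus>\<^bsub>?C\<^esub> \<Psi> = \<Psi> \<oplus>\<^bsub>?C\<^esub> \<Phi>"
      by (rule ext) (simp_all add: cartier_algebra_def c a_comm)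
  next
    fix \<Phi> assume \<Phi>: "\<Phi> \<in> carrier ?C"
    show "\<zero>\<^bsub>?C\<^esub> \<oplus>\<^bsub>?C\<^esub> \<Phi> = \<Phi>"
      by (rule ext) (simp_all add: homE[OF \<Phi>], simp_all add: cartier_algebra_def closed[OF \<Phi>] zero_map_def)
    let ?N = "\<lambda>e. \<lambda>x\<in>carrier R. \<ominus> \<Phi> e x"
    have "?N e \<in> cartier_hom p e R" for e
      using homD[OF \<Phi>, of e] closed[OF \<Phi>, of _ e] by (auto simp: cartier_hom_iff minus_add r_minus)
    moreover have "finite {e. ?N e \<noteq> zero_map R}"
    proof -
      have "{e. ?N e \<noteq> zero_map R} \<subseteq> {e. \<Phi> e \<noteq> zero_map R}" by (auto simp: zero_map_def)
      then show ?thesis using \<Phi> by (auto simp: cartier_algebra_def elim: finite_subset)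
    qed
    ultimately have "?N \<in> carrier ?C" by (simp add: cartier_algebra_def)
    moreover have "?N \<oplus>\<^bsub>?C\<^esub> \<Phi> = \<zero>\<^bsub>?C\<^esub>"
      by (rule ext) (simp_all add: cartier_algebra_def closed[OF \<Phi>] zero_map_def l_neg)
    ultimately show "\<exists>\<Psi>\<in>carrier ?C. \<Psi> \<oplus>\<^bsub>?C\<^esub> \<Phi> = \<zero>\<^bsub>?C\<^esub>" by blast
  qed
  show "monoid ?C"
  proof (rule monoidI)
    fix \<Phi> \<Psi> assume "\<Phi> \<in> carrier ?C" "\<Psi> \<in> carrier ?C"
    then show "\<Phi> \<otimes>\<^bsub>?C\<^esub> \<Psi> \<in> carrier ?C" by (rule mult_closed)
  next
    show "\<one>\<^bsub>?C\<^esub> \<in> carrier ?C" by (rule one_closed)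
  next
    fix \<Phi> \<Psi> X assume \<Phi>: "\<Phi> \<in> carrier ?C" and \<Psi>: "\<Psi> \<in> carrier ?C" and X: "X \<in> carrier ?C"
    note c = closed[OF \<Phi>] closed[OF \<Psi>] closed[OF X]
    show "\<Phi> \<otimes>\<^bsub>?C\<^esub> \<Psi> \<otimes>\<^bsub>?C\<^esub> X = \<Phi> \<otimes>\<^bsub>?C\<^esub> (\<Psi> \<otimes>\<^bsub>?C\<^esub> X)"
    proof (rule ext)
      fix g x assume x: "x \<in> carrier R"
      let ?h = "\<lambda>i j. \<Phi> i (\<Psi> j (X (g - i - j) x))"
      have h: "?h i j \<in> carrier R" for i j using c x by blast
      have "(\<Phi> \<otimes>\<^bsub>?C\<^esub> \<Psi> \<otimes>\<^bsub>?C\<^esub> X) g x =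
            (\<Oplus>k\<in>{..g}. \<Oplus>i\<in>{..k}. \<Phi> i (\<Psi> (k - i) (X (g - k) x)))"
        using x c by (auto simp: cartier_algebra_def intro!: finsum_cong' finsum_closed)
      also have "\<dots> = (\<Oplus>k\<in>{..g}. \<Oplus>i\<in>{..k}. ?h i (k - i))"
        using x c by (intro finsum_cong') auto
      also have "\<dots> = (\<Oplus>i\<in>{..g}. \<Oplus>j\<in>{..g - i}. ?h i j)"
        by (rule finsum_triangle) (rule h)
      also have "\<dots> = (\<Oplus>i\<in>{..g}. \<Phi> i (\<Oplus>j\<in>{..g - i}. \<Psi> j (X (g - i - j) x)))"
        using x c by (intro finsum_cong' cartier_hom_finsum[OF homD[OF \<Phi>], symmetric]) auto
      also have "\<dots> = (\<Phi> \<otimes>\<^bsub>?C\<^esub> (\<Psi> \<otimes>\<^bsub>?C\<^esub> X)) g x"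
        using x by (simp add: cartier_algebra_def)
      finally show "(\<Phi> \<otimes>\<^bsub>?C\<^esub> \<Psi> \<otimes>\<^bsub>?C\<^esub> X) g x = (\<Phi> \<otimes>\<^bsub>?C\<^esub> (\<Psi> \<otimes>\<^bsub>?C\<^esub> X)) g x" .
    qed (simp_all add: cartier_algebra_def)
  next
    fix \<Phi> assume \<Phi>: "\<Phi> \<in> carrier ?C"
    show "\<one>\<^bsub>?C\<^esub> \<otimes>\<^bsub>?C\<^esub> \<Phi> = \<Phi>"
    proof (rule ext)
      fix g x assume x: "x \<in> carrier R"
      have "(\<one>\<^bsub>?C\<^esub> \<otimes>\<^bsub>?C\<^esub> \<Phi>) g x = (\<Oplus>e\<in>{..g}. if 0 = e then \<Phi> (g - e) x else \<zero>)"
        using x closed[OF \<Phi>] by (auto simp: cartier_algebra_def zero_map_def intro!: finsum_cong')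
      also have "\<dots> = \<Phi> g x"
        using finsum_singleton[of 0 "{..g}" "\<lambda>e. \<Phi> (g - e) x"] x closed[OF \<Phi>] by (simp add: Pi_iff)
      finally show "(\<one>\<^bsub>?C\<^esub> \<otimes>\<^bsub>?C\<^esub> \<Phi>) g x = \<Phi> g x" .
    qed (simp_all add: homE[OF \<Phi>], simp add: cartier_algebra_def)
    show "\<Phi> \<otimes>\<^bsub>?C\<^esub> \<one>\<^bsub>?C\<^esub> = \<Phi>"
    proof (rule ext)
      fix g x assume x: "x \<in> carrier R"
      have "(\<Phi> \<otimes>\<^bsub>?C\<^esub> \<one>\<^bsub>?C\<^esub>) g x = (\<Oplus>e\<in>{..g}. if g = e then \<Phi> e x else \<zero>)"
        using x closed[OF \<Phi>] cartier_hom_zero[OF homD[OF \<Phi>]]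
        by (auto simp: cartier_algebra_def zero_map_def intro!: finsum_cong')
      also have "\<dots> = \<Phi> g x"
        using finsum_singleton[of g "{..g}" "\<lambda>e. \<Phi> e x"] x closed[OF \<Phi>] by (simp add: Pi_iff)
      finally show "(\<Phi> \<otimes>\<^bsub>?C\<^esub> \<one>\<^bsub>?C\<^esub>) g x = \<Phi> g x" .
    qed (simp_all add: homE[OF \<Phi>], simp add: cartier_algebra_def)
  qed
  fix \<Phi> \<Psi> X assume \<Phi>: "\<Phi> \<in> carrier ?C" and \<Psi>: "\<Psi> \<in> carrier ?C" and X: "X \<in> carrier ?C"
  note c = closed[OF \<Phi>] closed[OF \<Psi>] closed[OF X]
  show "(\<Phi> \<oplus>\<^bsub>?C\<^esub> \<Psi>) \<otimes>\<^bsub>?C\<^esub> X = \<Phi> \<otimes>\<^bsub>?C\<^esub> X \<oplus>\<^bsub>?C\<^esub> \<Psi> \<otimes>\<^bsub>?C\<^esub> X"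
  proof (rule ext)
    fix g x assume x: "x \<in> carrier R"
    show "((\<Phi> \<oplus>\<^bsub>?C\<^esub> \<Psi>) \<otimes>\<^bsub>?C\<^esub> X) g x = (\<Phi> \<otimes>\<^bsub>?C\<^esub> X \<oplus>\<^bsub>?C\<^esub> \<Psi> \<otimes>\<^bsub>?C\<^esub> X) g x"
      using x c by (simp add: cartier_algebra_def finsum_addf Pi_iff)
  qed (simp_all add: cartier_algebra_def)
  show "X \<otimes>\<^bsub>?C\<^esub> (\<Phi> \<oplus>\<^bsub>?C\<^esub> \<Psi>) = X \<otimes>\<^bsub>?C\<^esub> \<Phi> \<oplus>\<^bsub>?C\<^esub> X \<otimes>\<^bsub>?C\<^esub> \<Psi>"
  proof (rule ext)
    fix g x assume x: "x \<in> carrier R"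
    show "(X \<otimes>\<^bsub>?C\<^esub> (\<Phi> \<oplus>\<^bsub>?C\<^esub> \<Psi>)) g x = (X \<otimes>\<^bsub>?C\<^esub> \<Phi> \<oplus>\<^bsub>?C\<^esub> X \<otimes>\<^bsub>?C\<^esub> \<Psi>) g x"
      using x c cartier_hom_add[OF homD[OF X]] by (simp add: cartier_algebra_def finsum_addf Pi_iff)
  qed (simp_all add: cartier_algebra_def)
qed

end

text \<open>The degree zero part is \<open>R\<close>, acting by multiplication.\<close>

lemma (in cring) cartier_hom_degree_zero:
  "cartier_hom p 0 R = {(\<lambda>x\<in>carrier R. r \<otimes> x) | r. r \<in> carrier R}"
proof (intro equalityI subsetI)
  fix \<phi> assume \<phi>: "\<phi> \<in> cartier_hom p 0 R"
  have "\<phi> = (\<lambda>x\<in>carrier R. \<phi> \<one> \<otimes> x)"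
  proof (rule extensionalityI[of _ "carrier R"])
    show "\<phi> \<in> extensional (carrier R)"
      using \<phi> by (auto simp: cartier_hom_iff PiE_def)
    show "\<phi> x = (\<lambda>x\<in>carrier R. \<phi> \<one> \<otimes> x) x" if "x \<in> carrier R" for x
      using cartier_hom_smult[OF \<phi> one_closed that] cartier_hom_closed[OF \<phi>] that
      by (simp add: m_comm)
  qed simp
  then show "\<phi> \<in> {(\<lambda>x\<in>carrier R. r \<otimes> x) | r. r \<in> carrier R}"
    using cartier_hom_closed[OF \<phi> one_closed] by blast
qed (auto simp: cartier_hom_iff r_distr m_lcomm)

definition cartier_degree_zero :: "nat \<Rightarrow> ('a, 'r) ring_scheme \<Rightarrow> (nat \<Rightarrow> 'a \<Rightarrow> 'a) set" where
  "cartier_degree_zero p R = {\<Phi> \<in> carrier (cartier_algebra p R). \<forall>e>0. \<Phi> e = zero_map R}"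

definition cartier_principally_generated :: "nat \<Rightarrow> ('a, 'r) ring_scheme \<Rightarrow> bool" where
  "cartier_principally_generated p R \<longleftrightarrow>
     (\<exists>\<Phi>\<in>carrier (cartier_algebra p R).
        generate_ring (cartier_algebra p R) (cartier_degree_zero p R \<union> {\<Phi>}) =
        carrier (cartier_algebra p R))"

section \<open>F-finite fields\<close>

text \<open>
  The field \<open>K\<close> is a finite-dimensional vector space over the subfield of its \<open>p\<close>-th powers,
  where \<open>p\<close> is its (positive) characteristic; every perfect field has this property.
  This is the usual standing assumption for Cartier algebras of complete local rings.  It
  cannot be dropped: \<open>Hom(F\<^sub>*K, K)\<close> is one-dimensional over \<open>F\<^sub>*K\<close> if \<open>[K : K\<^sup>p]\<close> is finite
  but not if it is infinite, and then the Cartier algebra of \<open>K\<close>, the Stanley-Reisner ring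
  of the complex \<open>{\<emptyset>}\<close>, is not principally generated, although this complex has no free
  face.
\<close>

definition F_finite :: "'k::field itself \<Rightarrow> bool" where
  "F_finite _ \<longleftrightarrow> (\<exists>B::'k set. finite B \<and> (\<forall>x. \<exists>c. x = (\<Sum>b\<in>B. c b ^ CHAR('k) * b)))"

end

theory Submission
  imports Defs "HOL-Library.Nat_Bijection"
begin

text \<open>Write \<open>q = p\<^sup>e\<close>.  As in Fedder's criterion, every map of degree \<open>e\<close> is induced by
  \<open>f \<mapsto> \<Phi>\<^sup>e(s f)\<close> for the trace \<open>\<Phi>\<^sup>e\<close> of the power series ring and some power series \<open>s\<close>, and a
  monomial \<open>x\<^sup>m\<close> may occur in \<open>s\<close> iff for every nonface \<open>N\<close> the set of all \<open>i\<close> whose exponent in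
  \<open>x\<^sup>m \<Prod>\<^sub>i\<^sub>\<in>\<^sub>N x\<^sub>i\<close> is at least \<open>q\<close> is a nonface.  This depends only on \<open>A = {i. m\<^sub>i \<ge> q}\<close> and
  \<open>B = {i. m\<^sub>i \<ge> q - 1}\<close>, and \<open>x\<^sup>m\<close> acts nontrivially iff \<open>A\<close> is a face.

  If \<open>A\<close> is a face and \<open>i \<notin> B\<close>, then every facet containing \<open>A\<close> contains \<open>i\<close>, so removing \<open>i\<close> from
  such a facet gives a free face.  Hence, without free faces, all \<open>s\<close> are multiples of
  \<open>(x\<^sub>1 \<cdots> x\<^sub>n)\<^sup>q\<^sup>-\<^sup>1\<close>, and the map of degree 1 given by \<open>(x\<^sub>1 \<cdots> x\<^sub>n)\<^sup>p\<^sup>-\<^sup>1\<close> generates.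

  Conversely, a free face \<open>F\<close> with \<open>F \<union> {i}\<close> a facet yields the pair \<open>A = F\<close>, \<open>B = V - {i}\<close>.  The
  monomials of a minimal pair \<open>(A, B)\<close> with \<open>i \<notin> B\<close> then give, in each degree, a map that is not a
  combination of products of maps of smaller positive degree: in \<open>p\<^sup>b m + m'\<close>, minimality forces
  \<open>m\<close> to have type \<open>(A, B)\<close>, so all exponents of \<open>m'\<close> are below \<open>p\<^sup>b\<close> and its \<open>i\<close>-th exponent
  vanishes, which is not allowed because \<open>i\<close> lies in a nonface \<open>N\<close> such that \<open>N - {i}\<close> is a face.
  So no finite set of elements generates.\<close>

section \<open>Exponent vectors\<close>

type_synonym expo = "nat \<Rightarrow>\<^sub>0 nat"

abbreviation expo_at :: "expo \<Rightarrow> nat \<Rightarrow> nat" where "expo_at \<equiv> Poly_Mapping.lookup"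

abbreviation supp :: "expo \<Rightarrow> nat set" where "supp \<equiv> Poly_Mapping.keys"

text \<open>Meant for finite \<open>V\<close>, where the function has finite support as
  \<open>Abs_poly_mapping\<close> requires.\<close>

definition expo_on :: "nat set \<Rightarrow> (nat \<Rightarrow> nat) \<Rightarrow> expo" where
  "expo_on V f = Abs_poly_mapping (\<lambda>i. if i \<in> V then f i else 0)"

lemma expo_at_expo_on [simp]:
  assumes "finite V"
  shows "expo_at (expo_on V f) i = (if i \<in> V then f i else 0)"
proof -
  have "{i. (if i \<in> V then f i else 0) \<noteq> 0} \<subseteq> V" by auto
  with assms have "finite {i. (if i \<in> V then f i else 0) \<noteq> 0}" by (rule rev_finite_subset)
  then show ?thesis by (simp add: expo_on_def)
qed

lemma supp_expo_on: "finite V \<Longrightarrow> supp (expo_on V f) = {i \<in> V. f i \<noteq> 0}"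
  by (auto simp: in_keys_iff split: if_splits)

definition expo_scale :: "nat \<Rightarrow> expo \<Rightarrow> expo" where
  "expo_scale q m = Poly_Mapping.map ((*) q) m"

lemma expo_at_scale [simp]: "expo_at (expo_scale q m) i = q * expo_at m i"
  by (simp add: expo_scale_def Poly_Mapping.map.rep_eq when_def)

lemma expo_scale_inject: "q > 0 \<Longrightarrow> expo_scale q k = expo_scale q l \<longleftrightarrow> k = l"
  by (auto simp: poly_mapping_eq_iff fun_eq_iff)

lemma expo_eqI: "(\<And>i. expo_at k i = expo_at l i) \<Longrightarrow> k = l"
  by (rule poly_mapping_eqI)

lemma expo_splitI:
  assumes "\<And>i. expo_at k i \<le> expo_at m i"
  shows "\<exists>l::expo. m = k + l"
proof
  show "m = k + (m - k)"
    using assms by (intro expo_eqI) (simp add: lookup_add lookup_minus)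
qed

lemma finite_expo_divisors: "finite {a. \<exists>b. a + b = (m::expo)}"
proof -
  have "{a. \<exists>b. a + b = m} = fst ` {(a, b). a + b = m}" by force
  then show ?thesis using finite_monom_splits[of m] by simp
qed

section \<open>The ring of power series in countably many variables\<close>

text \<open>All coefficient families are allowed; since each monomial has finitely many divisors, the
  Cauchy product makes sense.  A face ring is a quotient of this ring whatever its number of
  variables, which removes side conditions on the variables in what follows.\<close>

typedef 'k mps = "UNIV :: (expo \<Rightarrow> 'k) set" morphisms mcoeff Mps ..

lemma mcoeff_Mps [simp]: "mcoeff (Mps f) = f"
  by (simp add: Mps_inverse)

lemma mps_eqI: "(\<And>m. mcoeff f m = mcoeff g m) \<Longrightarrow> f = g"
  by (metis ext mcoeff_inject)

instantiation mps :: (comm_ring_1) comm_ring_1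
begin

definition "0 = Mps (\<lambda>m. 0)"
definition "1 = Mps (\<lambda>m. if m = 0 then 1 else 0)"
definition "f + g = Mps (\<lambda>m. mcoeff f m + mcoeff g m)"
definition "f - g = Mps (\<lambda>m. mcoeff f m - mcoeff g m)"
definition "- f = Mps (\<lambda>m. - mcoeff f m)"
definition "f * g = Mps (\<lambda>m. \<Sum>(a, b) | a + b = m. mcoeff f a * mcoeff g b)"

instance
proof
  fix f g h :: "'a mps"
  show "f * g * h = f * (g * h)"
    by (rule mps_eqI) (simp add: times_mps_def pseries_mult_assoc)
  show "f * g = g * f"
    by (rule mps_eqI) (simp add: times_mps_def pseries_mult_commute[of "mcoeff f"])
  show "1 * f = f"
    by (rule mps_eqI) (simp add: times_mps_def one_mps_def pseries_mult_one)
  show "(f + g) * h = f * h + g * h"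
    by (rule mps_eqI)
       (simp add: times_mps_def plus_mps_def case_prod_unfold sum.distrib algebra_simps)
  show "(0 :: 'a mps) \<noteq> 1"
  proof
    assume "(0 :: 'a mps) = 1"
    then have "mcoeff (0 :: 'a mps) 0 = mcoeff 1 0" by simp
    then show False by (simp add: zero_mps_def one_mps_def)
  qed
qed (rule mps_eqI; simp add: zero_mps_def plus_mps_def minus_mps_def uminus_mps_def algebra_simps)+

end

lemma mcoeff_simps [simp]:
  "mcoeff 0 m = 0" "mcoeff 1 m = (if m = 0 then 1 else 0)"
  "mcoeff (f + g) m = mcoeff f m + mcoeff g m"
  "mcoeff (f - g) m = mcoeff f m - mcoeff g m"
  "mcoeff (- f) m = - mcoeff f m"
  by (simp_all add: zero_mps_def one_mps_def plus_mps_def minus_mps_def uminus_mps_def)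

lemma mcoeff_mult: "mcoeff (f * g) m = (\<Sum>(a, b) | a + b = m. mcoeff f a * mcoeff g b)"
  by (simp add: times_mps_def)

lemma mcoeff_mult_nonzero:
  assumes "mcoeff (f * g) m \<noteq> 0"
  obtains a b where "m = a + b" "mcoeff f a \<noteq> 0" "mcoeff g b \<noteq> 0"
proof -
  from assms obtain x where "x \<in> {(a, b). a + b = m}"
      "(case x of (a, b) \<Rightarrow> mcoeff f a * mcoeff g b) \<noteq> 0"
    unfolding mcoeff_mult by (rule sum.not_neutral_contains_not_neutral)
  then show thesis using that[of "fst x" "snd x"] by force
qed

lemma mcoeff_sum: "mcoeff (\<Sum>x\<in>A. f x) m = (\<Sum>x\<in>A. mcoeff (f x) m)"
  by (induction A rule: infinite_finite_induct) auto

definition mmonom :: "expo \<Rightarrow> 'k::comm_ring_1 \<Rightarrow> 'k mps" where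
  "mmonom m c = Mps (\<lambda>m'. if m' = m then c else 0)"

lemma mcoeff_mmonom: "mcoeff (mmonom m c) m' = (if m' = m then c else 0)"
  by (simp add: mmonom_def)

lemma mcoeff_mmonom_mult [simp]: "mcoeff (mmonom k c * f) (k + m) = c * mcoeff f m"
proof -
  have "mcoeff (mmonom k c * f) (k + m) = (\<Sum>(a, b)\<in>{(k, m)}. mcoeff (mmonom k c) a * mcoeff f b)"
    unfolding mcoeff_mult
    by (rule sum.mono_neutral_right[OF finite_monom_splits]) (auto simp: mcoeff_mmonom split: if_splits)
  then show ?thesis by (simp add: mcoeff_mmonom)
qed

lemma mcoeff_mmonom_mult_eq_0:
  assumes "\<And>l. m \<noteq> k + l"
  shows "mcoeff (mmonom k c * f) m = 0"
  using assms by (metis mcoeff_mult_nonzero mcoeff_mmonom)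

lemma mmonom_mult: "mmonom k c * mmonom l d = mmonom (k + l) (c * d)"
proof (rule mps_eqI)
  fix m
  show "mcoeff (mmonom k c * mmonom l d) m = mcoeff (mmonom (k + l) (c * d)) m"
  proof (cases "\<exists>r. m = k + r")
    case True
    then show ?thesis by (auto simp: mcoeff_mmonom)
  next
    case False
    then have "m \<noteq> k + l" by blast
    with False show ?thesis by (simp add: mcoeff_mmonom_mult_eq_0) (simp add: mcoeff_mmonom)
  qed
qed

lemma mmonom_0_1: "mmonom 0 1 = 1"
  by (rule mps_eqI) (simp add: mcoeff_mmonom)

lemma mmonom_power: "mmonom k c ^ n = mmonom (expo_scale n k) (c ^ n)"
proof (induction n)
  case 0
  have "expo_scale 0 k = 0" by (rule expo_eqI) simp
  then show ?case by (simp add: mmonom_0_1)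
next
  case (Suc n)
  have "k + expo_scale n k = expo_scale (Suc n) k" by (rule expo_eqI) (simp add: lookup_add)
  then show ?case by (simp add: Suc mmonom_mult)
qed

section \<open>Characteristic and Frobenius powers of power series\<close>

lemma CHAR_mps: "CHAR('k::comm_ring_1 mps) = CHAR('k)"
proof (rule CHAR_eqI)
  have of_nat: "of_nat n = mmonom 0 (of_nat n :: 'k)" for n
    by (induction n) (auto intro!: mps_eqI simp: mcoeff_mmonom)
  show "of_nat CHAR('k) = (0 :: 'k mps)"
    by (rule mps_eqI) (simp add: of_nat mcoeff_mmonom)
  fix n assume "of_nat n = (0 :: 'k mps)"
  from arg_cong[OF this, of "\<lambda>f. mcoeff f 0"] show "CHAR('k) dvd n"
    by (simp add: of_nat mcoeff_mmonom of_nat_eq_0_iff_char_dvd)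
qed

context
  fixes p e :: nat and g :: "'k::comm_ring_1 mps"
  assumes CHAR: "CHAR('k) = p" and prime: "prime p"
begin

text \<open>Only the finitely many divisors of \<open>m\<close> matter: split \<open>g\<close> into
  its terms at these divisors and a rest \<open>h\<close>. Taking \<open>q\<close>-th powers is
  additive, and every monomial of \<open>h ^ q\<close> is a multiple of one of \<open>h\<close>, so
  none is \<open>m\<close>. The index set has at most one element.\<close>

lemma mcoeff_frobenius:
  "mcoeff (g ^ (p ^ e)) m = (\<Sum>a | (\<exists>b. a + b = m) \<and> m = expo_scale (p ^ e) a. mcoeff g a ^ (p ^ e))"
proof -
  let ?q = "p ^ e" and ?D = "{a. \<exists>b. a + b = m}"
  have q: "?q > 0" using prime prime_gt_0_nat by simp
  define h where "h = g - (\<Sum>a\<in>?D. mmonom a (mcoeff g a))"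
  have h: "mcoeff h a = 0" if "a + b = m" for a b
    using that finite_expo_divisors[of m]
    by (auto simp: h_def mcoeff_sum mcoeff_mmonom)
  have hq: "mcoeff (h ^ ?q) m = 0"
  proof (rule ccontr)
    assume "mcoeff (h ^ ?q) m \<noteq> 0"
    moreover have "h ^ ?q = h * h ^ (?q - 1)"
      using q by (metis power_Suc Suc_diff_1)
    ultimately have "mcoeff (h * h ^ (?q - 1)) m \<noteq> 0" by metis
    then show False using h by (metis mcoeff_mult_nonzero)
  qed
  have "g ^ ?q = ((\<Sum>a\<in>?D. mmonom a (mcoeff g a)) + h) ^ ?q"
    by (simp add: h_def)
  also have "\<dots> = (\<Sum>a\<in>?D. mmonom (expo_scale ?q a) (mcoeff g a ^ ?q)) + h ^ ?q"
    using CHAR prime by (simp add: freshmans_dream' freshmans_dream_sum' CHAR_mps mmonom_power)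
  finally have "mcoeff (g ^ ?q) m = (\<Sum>a\<in>?D. if m = expo_scale ?q a then mcoeff g a ^ ?q else 0)"
    by (simp add: hq mcoeff_sum mcoeff_mmonom)
  also have "\<dots> = (\<Sum>a\<in>{a\<in>?D. m = expo_scale ?q a}. mcoeff g a ^ ?q)"
    using finite_expo_divisors[of m] by (rule sum.inter_filter[symmetric])
  finally show ?thesis by simp
qed

lemma mcoeff_frobenius_scale: "mcoeff (g ^ (p ^ e)) (expo_scale (p ^ e) m) = mcoeff g m ^ (p ^ e)"
proof -
  have q: "p ^ e > 0" using prime prime_gt_0_nat by simp
  then have "\<exists>b. m + b = expo_scale (p ^ e) m"
    using expo_splitI[of m "expo_scale (p ^ e) m"] by auto
  then have "{a. (\<exists>b. a + b = expo_scale (p ^ e) m) \<and> expo_scale (p ^ e) m = expo_scale (p ^ e) a} = {m}"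
    using q by (auto simp: expo_scale_inject)
  then show ?thesis by (simp add: mcoeff_frobenius)
qed

lemma mcoeff_frobenius_nonzero:
  assumes "mcoeff (g ^ (p ^ e)) m \<noteq> 0"
  obtains l where "m = expo_scale (p ^ e) l" "mcoeff g l \<noteq> 0"
proof -
  have "p ^ e > 0" using prime prime_gt_0_nat by simp
  moreover from assms obtain l where "m = expo_scale (p ^ e) l" "mcoeff g l ^ (p ^ e) \<noteq> 0"
    unfolding mcoeff_frobenius by (blast elim: sum.not_neutral_contains_not_neutral)
  ultimately show thesis using that[of l] by (cases "mcoeff g l = 0") (auto simp: power_0_left)
qed

end

section \<open>Traces of F-finite fields\<close>

text \<open>\<open>\<tau>\<close> is a coordinate function with respect to a basis over the field of \<open>p\<close>-th powers; the form
  \<open>\<tau>(x y)\<close> is nondegenerate, which gives the dual basis \<open>y\<close> of \<open>z\<close>.\<close>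

lemma frobenius_trace_exists:
  fixes p :: nat
  assumes CHAR: "CHAR('k::field) = p" and p: "p > 0" and "F_finite TYPE('k::field)"
  obtains \<tau> :: "'k::field \<Rightarrow> 'k" where
    "\<And>u v. \<tau> (u + v) = \<tau> u + \<tau> v" "\<And>c u. \<tau> (c ^ p * u) = c * \<tau> u"
    "\<exists>J :: nat set. \<exists>y z. finite J \<and> (\<forall>x. x = (\<Sum>j\<in>J. \<tau> (x * y j) ^ p * z j))"
proof -
  have prime: "prime p" using prime_CHAR_semidom[where 'a = 'k] CHAR p by simp
  have add: "(x + y) ^ p = x ^ p + y ^ p" for x y :: 'k
    using freshmans_dream[where ?'a = 'k and x = x and y = y] CHAR prime by simp
  \<comment> \<open>The field over its subfield of \<open>p\<close>-th powers, with the scalars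
    drawn from the whole field through Frobenius.\<close>
  interpret vs: vector_space "\<lambda>c x :: 'k. c ^ p * x"
    by unfold_locales (simp_all add: add algebra_simps)
  from assms(3) obtain B0 :: "'k set" where B0: "finite B0"
      "\<forall>x. \<exists>c. x = (\<Sum>b\<in>B0. c b ^ p * b)"
    using CHAR by (auto simp: F_finite_def)
  from vs.maximal_independent_subset obtain B where
    B: "B \<subseteq> B0" "vs.independent B" "B0 \<subseteq> vs.span B" by metis
  have finB: "finite B" using B B0 finite_subset by blast
  have span: "x \<in> vs.span B" for x
    using B0(2)[rule_format, of x] B(3)
    by (auto intro!: vs.span_sum vs.span_scale)
  have "B \<noteq> {}" using span[of 1] by (auto simp: vs.span_empty)
  then obtain b0 where b0: "b0 \<in> B" by auto
  define \<tau> where "\<tau> x = vs.representation B x b0" for x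
  have \<tau>_add: "\<tau> (x + y) = \<tau> x + \<tau> y" for x y
    by (simp add: \<tau>_def vs.representation_add[OF B(2) span span])
  have \<tau>_scale: "\<tau> (c ^ p * x) = c * \<tau> x" for c x
    by (simp add: \<tau>_def vs.representation_scale[OF B(2) span])
  have \<tau>_b0: "\<tau> b0 = 1" by (simp add: \<tau>_def vs.representation_basis[OF B(2) b0])
  have \<tau>_diff: "\<tau> (x - y) = \<tau> x - \<tau> y" for x y
    using \<tau>_add[of "x - y" y] by simp
  \<comment> \<open>Nondegeneracy of the form \<open>\<tau> (x * y)\<close>: a vector outside a span
    is separated from it by some \<open>y\<close>.\<close>
  have sep: "\<exists>y. (\<forall>a'\<in>A. \<tau> (a' * y) = 0) \<and> \<tau> (a * y) = 1"
    if "finite A" "a \<notin> vs.span A" for A a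
    using that
  proof (induction A arbitrary: a rule: finite_induct)
    case empty
    then have "a \<noteq> 0" using vs.span_zero by metis
    then show ?case using \<tau>_b0 by (intro exI[of _ "b0 / a"]) simp
  next
    case (insert a1 A)
    show ?case
    proof (cases "a1 \<in> vs.span A")
      case True
      with insert.prems have "a \<notin> vs.span A"
        using vs.span_redundant[OF True] by simp
      from insert.IH[OF this] obtain y where y: "\<forall>a'\<in>A. \<tau> (a' * y) = 0" "\<tau> (a * y) = 1" by auto
      have "\<tau> (a' * y) = 0" if "a' \<in> vs.span A" for a'
        using that
      proof (induction rule: vs.span_induct_alt)
        case base
        show ?case using \<tau>_scale[of 0 0] p by simp
      next
        case (step c x y')
        then show ?case using y(1) by (simp add: \<tau>_add \<tau>_scale distrib_right mult.assoc)
      qed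
      with True y show ?thesis by auto
    next
      case False
      from insert.IH[OF False] obtain y1 where
        y1: "\<forall>a'\<in>A. \<tau> (a' * y1) = 0" "\<tau> (a1 * y1) = 1" by auto
      let ?c = "\<tau> (a * y1)"
      have "a - ?c ^ p * a1 \<notin> vs.span A"
      proof
        assume "a - ?c ^ p * a1 \<in> vs.span A"
        then have "a - ?c ^ p * a1 \<in> vs.span (insert a1 A)"
          using vs.span_mono[OF subset_insertI] by blast
        moreover have "?c ^ p * a1 \<in> vs.span (insert a1 A)"
          by (intro vs.span_scale vs.span_base) simp
        ultimately have "a - ?c ^ p * a1 + ?c ^ p * a1 \<in> vs.span (insert a1 A)"
          by (rule vs.span_add)
        with insert.prems show False by simp
      qed
      from insert.IH[OF this] obtain z where
        z: "\<forall>a'\<in>A. \<tau> (a' * z) = 0" "\<tau> ((a - ?c ^ p * a1) * z) = 1" by auto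
      \<comment> \<open>The correction by \<open>y1\<close> makes the pairing with \<open>a1\<close>
        vanish, and the pairing with \<open>a\<close> becomes that of \<open>a - ?c ^ p * a1\<close>
        with \<open>z\<close>, which is 1.\<close>
      let ?y = "z - \<tau> (a1 * z) ^ p * y1"
      have y: "\<tau> (x * ?y) = \<tau> (x * z) - \<tau> (a1 * z) * \<tau> (x * y1)" for x
        by (simp add: right_diff_distrib mult.left_commute[of x] \<tau>_diff \<tau>_scale)
      have "\<tau> (a * z) - \<tau> (a1 * z) * ?c = 1"
        using z(2) by (simp add: left_diff_distrib mult.assoc \<tau>_diff \<tau>_scale mult.commute[of ?c])
      then show ?thesis
        using z(1) y1 by (intro exI[of _ ?y]) (simp add: y)
    qed
  qed
  have "\<exists>y. (\<forall>b'\<in>B - {b}. \<tau> (b' * y) = 0) \<and> \<tau> (b * y) = 1" if "b \<in> B" for b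
    using sep[of "B - {b}" b] finB B(2) that by (auto simp: vs.dependent_def)
  then obtain y where y: "\<And>b. b \<in> B \<Longrightarrow> (\<forall>b'\<in>B - {b}. \<tau> (b' * y b) = 0) \<and> \<tau> (b * y b) = 1"
    by metis
  have \<tau>_sum: "\<tau> (sum f A) = (\<Sum>a\<in>A. \<tau> (f a))" for f and A :: "'k set"
    using \<tau>_scale[of 0 0] p by (induction A rule: infinite_finite_induct) (simp_all add: \<tau>_add)
  have coord: "x = (\<Sum>b\<in>B. \<tau> (x * y b) ^ p * b)" for x
  proof -
    let ?r = "vs.representation B x"
    have x: "x = (\<Sum>b\<in>B. ?r b ^ p * b)"
      by (rule vs.sum_representation_eq[OF B(2) span finB, symmetric]) simp
    have "\<tau> (x * y b) = ?r b" if b: "b \<in> B" for b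
    proof -
      have "\<tau> (x * y b) = (\<Sum>b'\<in>B. ?r b' * \<tau> (b' * y b))"
        by (subst x) (simp add: sum_distrib_right \<tau>_sum mult.assoc \<tau>_scale)
      also have "\<dots> = (\<Sum>b'\<in>{b}. ?r b' * \<tau> (b' * y b))"
        using b y[OF b] finB by (intro sum.mono_neutral_right) auto
      also have "\<dots> = ?r b" using y[OF b] by simp
      finally show ?thesis .
    qed
    then show ?thesis by (subst x) (intro sum.cong refl, simp)
  qed
  \<comment> \<open>Natural numbers as indices keep the index type fixed when the dual bases of
    iterates of \<open>\<tau>\<close> are multiplied.\<close>
  from finB obtain h where h: "bij_betw h {0..<card B} B"
    using ex_bij_betw_nat_finite by blast
  have "x = (\<Sum>j\<in>{0..<card B}. \<tau> (x * y (h j)) ^ p * h j)" for x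
    using coord[of x] sum.reindex_bij_betw[OF h, of "\<lambda>b. \<tau> (x * y b) ^ p * b"] by simp
  then have "\<exists>J :: nat set. \<exists>y z. finite J \<and> (\<forall>x. x = (\<Sum>j\<in>J. \<tau> (x * y j) ^ p * z j))"
    by (intro exI[of _ "{0..<card B}"] exI[of _ "\<lambda>j. y (h j)"] exI[of _ h]) blast
  with \<tau>_add \<tau>_scale show thesis by (rule that)
qed

section \<open>Traces of power series\<close>

locale frobenius_trace =
  fixes p :: nat and \<tau> :: "'k::field \<Rightarrow> 'k" and V :: "nat set"
  assumes CHAR: "CHAR('k) = p" and p_pos: "p > 0"
    and \<tau>_add: "\<tau> (x + y) = \<tau> x + \<tau> y"
    and \<tau>_scale: "\<tau> (c ^ p * x) = c * \<tau> x"
    and \<tau>_dual: "\<exists>J :: nat set. \<exists>y z. finite J \<and> (\<forall>x. x = (\<Sum>j\<in>J. \<tau> (x * y j) ^ p * z j))"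
    and finite_V: "finite V"
begin

lemma prime_p: "prime p"
  using prime_CHAR_semidom[where 'a = 'k] CHAR p_pos by simp

lemma p_ge_2: "p \<ge> 2"
  using prime_p by (rule prime_ge_2_nat)

declare p_pos [simp]

lemma pow_pos: "p ^ e > 0"
  by simp

section \<open>Iterates of the trace on the coefficient field\<close>

lemma \<tau>_pow_add: "(\<tau> ^^ e) (x + y) = (\<tau> ^^ e) x + (\<tau> ^^ e) y"
  by (induction e) (simp_all add: \<tau>_add)

lemma \<tau>_pow_scale: "(\<tau> ^^ e) (c ^ (p ^ e) * x) = c * (\<tau> ^^ e) x"
proof (induction e arbitrary: c)
  case (Suc e)
  have "c ^ (p ^ Suc e) = (c ^ p) ^ (p ^ e)" by (simp flip: power_mult)
  with Suc[of "c ^ p"] show ?case by (simp add: \<tau>_scale)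
qed simp

lemma \<tau>_pow_0 [simp]: "(\<tau> ^^ e) 0 = 0"
  using \<tau>_pow_scale[of e 0 0] by simp

lemma \<tau>_pow_sum: "(\<tau> ^^ e) (sum f A) = (\<Sum>a\<in>A. (\<tau> ^^ e) (f a))"
  by (induction A rule: infinite_finite_induct) (simp_all add: \<tau>_pow_add)

lemma frobenius_sum: "(\<Sum>a\<in>A. f a :: 'k) ^ (p ^ e) = (\<Sum>a\<in>A. f a ^ (p ^ e))"
  using CHAR prime_p by (simp add: freshmans_dream_sum')

text \<open>Dual bases multiply as in a tower of fields: expand \<open>x\<close> in the basis for
  \<open>\<tau>\<close>, expand each coordinate in the basis for the \<open>e\<close>-th iterate,
  and take \<open>p\<close>-th powers. The pairs of indices are coded as numbers.\<close>

lemma \<tau>_pow_dual: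
  "\<exists>J :: nat set. \<exists>y z. finite J \<and> (\<forall>x. x = (\<Sum>j\<in>J. (\<tau> ^^ e) (x * y j) ^ (p ^ e) * z j))"
proof (induction e)
  case 0
  show ?case by (intro exI[of _ "{0}"] exI[of _ "\<lambda>_. 1"]) simp
next
  case (Suc e)
  from \<tau>_dual obtain J :: "nat set" and y z where J: "finite J"
    and x: "x = (\<Sum>j\<in>J. \<tau> (x * y j) ^ p * z j)" for x by metis
  from Suc obtain J' :: "nat set" and y' z' where J': "finite J'"
    and x': "x = (\<Sum>j\<in>J'. (\<tau> ^^ e) (x * y' j) ^ (p ^ e) * z' j)" for x by metis
  let ?Y = "\<lambda>k. case prod_decode k of (i, j) \<Rightarrow> y i * y' j ^ p"
  let ?Z = "\<lambda>k. case prod_decode k of (i, j) \<Rightarrow> z' j ^ p * z i"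
  have frob_p: "(\<Sum>a\<in>A. f a :: 'k) ^ p = (\<Sum>a\<in>A. f a ^ p)" for f and A :: "nat set"
    using frobenius_sum[where e = 1] by simp
  have "x = (\<Sum>k\<in>prod_encode ` (J \<times> J'). (\<tau> ^^ Suc e) (x * ?Y k) ^ (p ^ Suc e) * ?Z k)" for x
  proof -
    have inner: "\<tau> (x * y i) ^ p = (\<Sum>j\<in>J'. (\<tau> ^^ Suc e) (x * (y i * y' j ^ p)) ^ (p ^ Suc e) * z' j ^ p)"
      for i
    proof -
      have "\<tau> (x * y i) * y' j = \<tau> (x * (y i * y' j ^ p))" for j
        using \<tau>_scale[of "y' j" "x * y i"] by (simp add: ac_simps)
      then have "\<tau> (x * y i) = (\<Sum>j\<in>J'. (\<tau> ^^ Suc e) (x * (y i * y' j ^ p)) ^ (p ^ e) * z' j)"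
        using x'[of "\<tau> (x * y i)"] by (simp add: funpow_swap1)
      then show ?thesis
        by (simp add: frob_p power_mult_distrib mult.commute[of p] flip: power_mult)
    qed
    have "(\<Sum>k\<in>prod_encode ` (J \<times> J'). (\<tau> ^^ Suc e) (x * ?Y k) ^ (p ^ Suc e) * ?Z k) =
        (\<Sum>(i, j)\<in>J \<times> J'. (\<tau> ^^ Suc e) (x * (y i * y' j ^ p)) ^ (p ^ Suc e) * (z' j ^ p * z i))"
      by (subst sum.reindex) (auto simp: inj_prod_encode case_prod_unfold)
    also have "\<dots> = (\<Sum>i\<in>J. \<tau> (x * y i) ^ p * z i)"
      by (simp add: inner sum_distrib_right mult.assoc flip: sum.cartesian_product)
    finally show ?thesis using x[of x] by metis
  qed
  then show ?case
    using J J' by (intro exI[of _ "prod_encode ` (J \<times> J')"] exI[of _ ?Y] exI[of _ ?Z]) auto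
qed

text \<open>If all these values vanished, the dual basis expansion of \<open>x\<close> would be
  zero.\<close>

lemma \<tau>_pow_nonzero:
  assumes "x \<noteq> 0" obtains c where "(\<tau> ^^ e) (x * c) \<noteq> 0"
proof -
  obtain J :: "nat set" and y z where
    "\<And>x. x = (\<Sum>j\<in>J. (\<tau> ^^ e) (x * y j) ^ (p ^ e) * z j)" using \<tau>_pow_dual by metis
  with assms have "(\<Sum>j\<in>J. (\<tau> ^^ e) (x * y j) ^ (p ^ e) * z j) \<noteq> 0" by metis
  then obtain j where "(\<tau> ^^ e) (x * y j) ^ (p ^ e) * z j \<noteq> 0"
    by (blast elim: sum.not_neutral_contains_not_neutral)
  then show thesis using that[of "y j"] by (cases "(\<tau> ^^ e) (x * y j) = 0") (use p_pos in \<open>auto simp: power_0_left\<close>)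
qed

text \<open>The largest exponent on \<open>V\<close> with all entries below \<open>q\<close>: the
  socle monomial modulo the \<open>q\<close>-th powers of the variables in \<open>V\<close>.\<close>

definition corner :: "nat \<Rightarrow> expo" where
  "corner q = expo_on V (\<lambda>_. q - 1)"

lemma expo_at_corner [simp]: "expo_at (corner q) i = (if i \<in> V then q - 1 else 0)"
  using finite_V by (simp add: corner_def)

text \<open>The trace sends \<open>c x\<^sup>m\<close> to \<open>\<tau>\<^sup>e(c) x\<^sup>r\<close> if \<open>m\<^sub>i = q r\<^sub>i + q - 1\<close> for \<open>i \<in> V\<close> and
  \<open>m\<^sub>i = q r\<^sub>i\<close> otherwise, and to 0 if there is no such \<open>r\<close>.\<close>

definition tr :: "nat \<Rightarrow> 'k mps \<Rightarrow> 'k mps" where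
  "tr e f = Mps (\<lambda>r. (\<tau> ^^ e) (mcoeff f (expo_scale (p ^ e) r + corner (p ^ e))))"

lemma mcoeff_tr: "mcoeff (tr e f) r = (\<tau> ^^ e) (mcoeff f (expo_scale (p ^ e) r + corner (p ^ e)))"
  by (simp add: tr_def)

lemma tr_add: "tr e (f + g) = tr e f + tr e g"
  by (rule mps_eqI) (simp add: mcoeff_tr \<tau>_pow_add)

lemma tr_0 [simp]: "tr e 0 = 0"
  by (rule mps_eqI) (simp add: mcoeff_tr)

lemma tr_sum: "tr e (sum f A) = (\<Sum>a\<in>A. tr e (f a))"
  by (induction A rule: infinite_finite_induct) (simp_all add: tr_add)

lemma tr_diff: "tr e (f - g) = tr e f - tr e g"
  using tr_add[of e "f - g" g] by simp

text \<open>The two corners combine because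
  \<open>p^b (p^a - 1) + (p^b - 1) = p^(a+b) - 1\<close>.\<close>

lemma tr_tr: "tr a (tr b f) = tr (a + b) f"
proof (rule mps_eqI)
  fix r
  have "(1::nat) \<le> p ^ a" "(1::nat) \<le> p ^ b" using pow_pos by (simp_all add: Suc_leI)
  then have "expo_scale (p ^ b) (expo_scale (p ^ a) r + corner (p ^ a)) + corner (p ^ b) =
        expo_scale (p ^ (a + b)) r + corner (p ^ (a + b))"
    by (intro expo_eqI) (auto simp: lookup_add power_add algebra_simps)
  then show "mcoeff (tr a (tr b f)) r = mcoeff (tr (a + b) f) r"
    by (simp add: mcoeff_tr funpow_add)
qed

text \<open>In a splitting \<open>a + b\<close> of \<open>q r\<close> plus the corner with
  \<open>a = q c\<close>, the corner entries below \<open>q\<close> force \<open>c \<le> r\<close>,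
  so \<open>b\<close> is \<open>q (r - c)\<close> plus the corner. Hence the relevant splittings
  correspond to those of \<open>r\<close>.\<close>

lemma tr_frobenius: "tr e (g ^ (p ^ e) * f) = g * tr e f"
proof (rule mps_eqI)
  fix r
  let ?q = "p ^ e"
  let ?h = "\<lambda>(c, d). (expo_scale ?q c, expo_scale ?q d + corner ?q)"
  let ?T = "\<lambda>x. mcoeff (g ^ ?q) (fst x) * mcoeff f (snd x)"
  have "inj_on ?h {(c, d). c + d = r}"
    by (rule inj_onI) (auto simp: expo_scale_inject)
  moreover have "(\<Sum>x\<in>{(a, b). a + b = expo_scale ?q r + corner ?q}. ?T x) = (\<Sum>x\<in>?h ` {(c, d). c + d = r}. ?T x)"
  proof (rule sum.mono_neutral_right[OF finite_monom_splits])
    show "?h ` {(c, d). c + d = r} \<subseteq> {(a, b). a + b = expo_scale ?q r + corner ?q}"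
      by (auto intro!: expo_eqI simp: lookup_add algebra_simps)
    show "\<forall>x\<in>{(a, b). a + b = expo_scale ?q r + corner ?q} - ?h ` {(c, d). c + d = r}. ?T x = 0"
    proof (rule ballI, rule ccontr)
      fix x assume x: "x \<in> {(a, b). a + b = expo_scale ?q r + corner ?q} - ?h ` {(c, d). c + d = r}"
        and "?T x \<noteq> 0"
      then obtain a b where ab: "x = (a, b)" "a + b = expo_scale ?q r + corner ?q"
        "mcoeff (g ^ ?q) a \<noteq> 0" by auto
      from mcoeff_frobenius_nonzero[OF CHAR prime_p ab(3)] obtain c where c: "a = expo_scale ?q c" .
      have ab': "?q * expo_at c i + expo_at b i = ?q * expo_at r i + expo_at (corner ?q) i" for i
        using arg_cong[OF ab(2), of "\<lambda>k. expo_at k i"] by (simp add: c lookup_add)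
      have "expo_at c i \<le> expo_at r i" for i
      proof (rule ccontr)
        assume "\<not> expo_at c i \<le> expo_at r i"
        then have "?q * (expo_at r i + 1) \<le> ?q * expo_at c i" by (intro mult_le_mono2) simp
        moreover have "expo_at (corner ?q) i < ?q" using pow_pos[of e] by auto
        ultimately show False using ab'[of i] by simp
      qed
      from expo_splitI[of c r, OF this] obtain d where d: "r = c + d" by auto
      have "b = expo_scale ?q d + corner ?q"
        using ab' by (intro expo_eqI) (auto simp: d lookup_add algebra_simps)
      with c d ab(1) have "x \<in> ?h ` {(c, d). c + d = r}" by auto
      with x show False by blast
    qed
  qed
  ultimately have "mcoeff (g ^ ?q * f) (expo_scale ?q r + corner ?q) =
      (\<Sum>x\<in>{(c, d). c + d = r}. ?T (?h x))"
    by (simp add: mcoeff_mult case_prod_unfold sum.reindex)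
  also have "\<dots> = (\<Sum>(c, d)\<in>{(c, d). c + d = r}. mcoeff g c ^ ?q * mcoeff f (expo_scale ?q d + corner ?q))"
    by (rule sum.cong) (auto simp: mcoeff_frobenius_scale[OF CHAR prime_p])
  finally show "mcoeff (tr e (g ^ ?q * f)) r = mcoeff (g * tr e f) r"
    by (simp add: mcoeff_tr mcoeff_mult \<tau>_pow_sum case_prod_unfold \<tau>_pow_scale)
qed

text \<open>The monomials with exponent at most the corner, times a basis of the field over its
  \<open>q\<close>-th powers, form a basis over the \<open>q\<close>-th powers of series in the
  variables of \<open>V\<close>. The dual of \<open>x^a\<close> has the complementary exponent
  \<open>corner ?q - a\<close>. For variables outside \<open>V\<close> the trace sees only exponents
  divisible by \<open>q\<close>, whence the restriction on \<open>m\<close>.\<close>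

lemma tr_dual:
  "\<exists>(J :: (nat \<times> expo) set) Y Z. finite J \<and>
     (\<forall>f m. supp m \<subseteq> V \<longrightarrow> mcoeff (\<Sum>j\<in>J. tr e (f * Y j) ^ (p ^ e) * Z j) m = mcoeff f m)"
proof -
  let ?q = "p ^ e"
  obtain J :: "nat set" and y z where J: "finite J"
    and x: "x = (\<Sum>j\<in>J. (\<tau> ^^ e) (x * y j) ^ ?q * z j)" for x using \<tau>_pow_dual by metis
  let ?B = "{a. \<exists>b. a + b = corner ?q}"
  have B: "finite ?B" by (rule finite_expo_divisors)
  let ?Y = "\<lambda>(j, a). mmonom (corner ?q - a) (y j)" and ?Z = "\<lambda>(j, a). mmonom a (z j)"
  have "mcoeff (\<Sum>j\<in>J \<times> ?B. tr e (f * ?Y j) ^ ?q * ?Z j) m = mcoeff f m"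
    if m: "supp m \<subseteq> V" for f m
  proof -
    \<comment> \<open>Division of \<open>m\<close> by \<open>q\<close> with remainder
      \<open>a0\<close>; only the basis elements with monomial \<open>x^a0\<close> contribute at
      \<open>m\<close>.\<close>
    define a0 r where "a0 = expo_on V (\<lambda>i. expo_at m i mod ?q)" and "r = expo_on V (\<lambda>i. expo_at m i div ?q)"
    have m_out: "expo_at m i = 0" if "i \<notin> V" for i
      using m that by (auto simp: in_keys_iff)
    have m_eq: "m = a0 + expo_scale ?q r"
      by (rule expo_eqI) (auto simp: a0_def r_def lookup_add finite_V m_out)
    have a0_le: "expo_at a0 i \<le> expo_at (corner ?q) i" for i
    proof -
      have "expo_at m i mod ?q \<le> ?q - 1" using mod_less_divisor[OF pow_pos, of "expo_at m i" e] by linarith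
      then show ?thesis by (simp add: a0_def finite_V)
    qed
    from expo_splitI[OF a0_le] obtain a1 where a1: "corner ?q = a0 + a1" by auto
    have a0: "a0 \<in> ?B" using a1 by auto
    have other: "mcoeff (G ^ ?q * mmonom a w) m = 0" if a: "a \<in> ?B" "a \<noteq> a0" for G :: "'k mps" and a w
    proof (rule ccontr)
      assume "mcoeff (G ^ ?q * mmonom a w) m \<noteq> 0"
      then obtain b where b: "m = b + a" "mcoeff (G ^ ?q) b \<noteq> 0"
        by (auto elim!: mcoeff_mult_nonzero simp: mcoeff_mmonom split: if_splits)
      from mcoeff_frobenius_nonzero[OF CHAR prime_p b(2)] obtain l where l: "b = expo_scale ?q l" .
      have "expo_at a i = expo_at a0 i" for i
      proof -
        from a(1) obtain b' where "a + b' = corner ?q" by auto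
        from arg_cong[OF this, of "\<lambda>k. expo_at k i"] have "expo_at a i + expo_at b' i \<le> ?q - 1"
          by (auto simp: lookup_add split: if_splits)
        then have *: "expo_at a i < ?q" using pow_pos[of e] by linarith
        have "expo_at m i = ?q * expo_at l i + expo_at a i" by (simp add: b l lookup_add)
        with * have "expo_at m i mod ?q = expo_at a i" by simp
        then show ?thesis using m_out[of i] by (auto simp: a0_def finite_V)
      qed
      then have "a = a0" by (rule expo_eqI)
      with a(2) show False by simp
    qed
    have main: "mcoeff (tr e (f * mmonom (corner ?q - a0) w) ^ ?q * mmonom a0 w') m =
        (\<tau> ^^ e) (mcoeff f m * w) ^ ?q * w'" for w w'
    proof -
      have "mcoeff (tr e (f * mmonom a1 w) ^ ?q * mmonom a0 w') m =
          w' * mcoeff (tr e (f * mmonom a1 w)) r ^ ?q"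
        using mcoeff_mmonom_mult[of a0 w' "tr e (f * mmonom a1 w) ^ ?q" "expo_scale ?q r"]
        by (simp add: mult.commute[of _ "mmonom a0 w'"] mcoeff_frobenius_scale[OF CHAR prime_p] flip: m_eq)
      moreover have "expo_scale ?q r + corner ?q = a1 + m"
        by (simp add: a1 m_eq ac_simps)
      then have "mcoeff (tr e (f * mmonom a1 w)) r = (\<tau> ^^ e) (w * mcoeff f m)"
        by (simp add: mcoeff_tr mult.commute[of f])
      moreover have "corner ?q - a0 = a1" by (simp add: a1)
      ultimately show ?thesis by (simp add: ac_simps)
    qed
    have "mcoeff (\<Sum>j\<in>J \<times> ?B. tr e (f * ?Y j) ^ ?q * ?Z j) m =
        (\<Sum>j\<in>J. \<Sum>a\<in>?B. mcoeff (tr e (f * mmonom (corner ?q - a) (y j)) ^ ?q * mmonom a (z j)) m)"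
      by (simp add: mcoeff_sum sum.cartesian_product case_prod_unfold)
    also have "\<dots> = (\<Sum>j\<in>J. \<Sum>a\<in>{a0}. mcoeff (tr e (f * mmonom (corner ?q - a) (y j)) ^ ?q * mmonom a (z j)) m)"
      using a0 B by (intro sum.cong refl sum.mono_neutral_right) (auto intro: other)
    also have "\<dots> = mcoeff f m"
      using x[of "mcoeff f m"] by (simp add: main)
    finally show ?thesis .
  qed
  then show ?thesis
    using J B by (intro exI[of _ "J \<times> ?B"] exI[of _ ?Y] exI[of _ ?Z]) auto
qed

end

section \<open>Cartier maps of a face ring\<close>

text \<open>The kernel of \<open>proj\<close> consists of the series all of whose monomials have
  nonface support. It contains the variables outside \<open>V\<close>, since faces are subsets of
  \<open>V\<close>.\<close>

locale face_ring = frobenius_trace p \<tau> V + cring R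
  for p :: nat and \<tau> :: "'k::field \<Rightarrow> 'k" and V :: "nat set"
    and R :: "('r, 'm) ring_scheme" (structure) +
  fixes \<Delta> :: "nat set set" and proj :: "'k mps \<Rightarrow> 'r"
  assumes face_subset: "F \<in> \<Delta> \<Longrightarrow> F \<subseteq> V"
    and face_down: "F \<in> \<Delta> \<Longrightarrow> G \<subseteq> F \<Longrightarrow> G \<in> \<Delta>"
    and range_proj: "range proj = carrier R"
    and proj_add: "proj (f + g) = proj f \<oplus> proj g"
    and proj_mult: "proj (f * g) = proj f \<otimes> proj g"
    and proj_1: "proj 1 = \<one>"
    and proj_eq_0_iff: "proj f = \<zero> \<longleftrightarrow> (\<forall>m. mcoeff f m \<noteq> 0 \<longrightarrow> supp m \<notin> \<Delta>)"
begin

lemma proj_closed [simp]: "proj f \<in> carrier R"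
  using range_proj by blast

lemma proj_cases:
  assumes "x \<in> carrier R" obtains f where "x = proj f"
  using assms range_proj by auto

lemma proj_0 [simp]: "proj 0 = \<zero>"
  by (simp add: proj_eq_0_iff)

lemma proj_uminus: "proj (- f) = \<ominus> proj f"
proof (rule minus_equality[symmetric])
  show "proj (- f) \<oplus> proj f = \<zero>" by (simp flip: proj_add)
qed simp_all

lemma proj_eqI: "proj (f - g) = \<zero> \<Longrightarrow> proj f = proj g"
  using proj_add[of "f - g" g] by simp

lemma proj_power: "proj (f ^ n) = proj f [^] n"
  by (induction n) (simp_all add: proj_1 proj_mult m_comm)

section \<open>Fedder's criterion in terms of exponents\<close>

definition high :: "nat \<Rightarrow> expo \<Rightarrow> nat set" where
  "high q m = {i \<in> V. q \<le> expo_at m i}"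

text \<open>If \<open>r\<close> vanishes at \<open>i\<close>, the entries of \<open>a\<close> and
  \<open>b\<close> there add up to \<open>q - 1\<close> for \<open>i \<in> V\<close> and to 0
  otherwise, which excludes each of the three premises.\<close>

lemma trace_exponent:
  assumes "a + b = expo_scale q r + corner q" and "q > 0"
  shows "i \<notin> V \<Longrightarrow> i \<in> supp a \<union> supp b \<Longrightarrow> i \<in> supp r"
    and "i \<in> high q a \<Longrightarrow> i \<in> supp r"
    and "i \<in> high (q - 1) a \<Longrightarrow> i \<in> supp b \<Longrightarrow> i \<in> supp r"
proof -
  have i: "expo_at a i + expo_at b i = q * expo_at r i + (if i \<in> V then q - 1 else 0)"
    using arg_cong[OF assms(1), of "\<lambda>k. expo_at k i"] by (simp add: lookup_add)
  show "i \<notin> V \<Longrightarrow> i \<in> supp a \<union> supp b \<Longrightarrow> i \<in> supp r"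
    "i \<in> high q a \<Longrightarrow> i \<in> supp r"
    "i \<in> high (q - 1) a \<Longrightarrow> i \<in> supp b \<Longrightarrow> i \<in> supp r"
    using i assms(2) by (cases "expo_at r i = 0"; force simp: in_keys_iff high_def)+
qed

text \<open>For \<open>A = high q m\<close> and \<open>B = high (q - 1) m\<close> this says that \<open>x\<^sup>m\<close> multiplies \<open>I\<close> into
  its Frobenius power, that is \<open>x\<^sup>m \<in> (I\<^sup>[\<^sup>q\<^sup>] : I)\<close>.\<close>

definition admissible :: "nat set \<Rightarrow> nat set \<Rightarrow> bool" where
  "admissible A B \<longleftrightarrow> A \<subseteq> B \<and> B \<subseteq> V \<and> (\<forall>N\<subseteq>V. N \<notin> \<Delta> \<longrightarrow> A \<union> (B \<inter> N) \<notin> \<Delta>)"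

text \<open>Serves to discard terms of \<open>s\<close> that act trivially: a trace monomial coming
  from \<open>x^m\<close> involves all of \<open>high (p ^ e) m\<close>, and also every variable of
  \<open>x^m\<close> outside \<open>V\<close>.\<close>

lemma proj_tr_eq_0I:
  assumes "\<And>m. mcoeff s m \<noteq> 0 \<Longrightarrow> supp m \<subseteq> V \<Longrightarrow> high (p ^ e) m \<notin> \<Delta>"
  shows "proj (tr e (s * f)) = \<zero>"
proof -
  have "supp r \<notin> \<Delta>" if "mcoeff (tr e (s * f)) r \<noteq> 0" for r
  proof -
    from that have "mcoeff (s * f) (expo_scale (p ^ e) r + corner (p ^ e)) \<noteq> 0"
      by (auto simp: mcoeff_tr)
    then obtain a b where ab: "a + b = expo_scale (p ^ e) r + corner (p ^ e)" "mcoeff s a \<noteq> 0"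
      by (metis mcoeff_mult_nonzero)
    note exponent = trace_exponent[OF ab(1) pow_pos]
    show ?thesis
    proof (cases "supp a \<subseteq> V")
      case True
      then show ?thesis using assms[OF ab(2) True] exponent(2) face_down by blast
    next
      case False
      then show ?thesis using exponent(1) face_subset by blast
    qed
  qed
  then show ?thesis by (simp add: proj_eq_0_iff)
qed

text \<open>Sufficiency in Fedder's criterion. A trace monomial coming from \<open>x^a\<close> in
  \<open>s\<close> and \<open>x^b\<close> in \<open>f\<close> has in its support the set that
  admissibility of \<open>x^a\<close> declares a nonface for \<open>N = supp b\<close>.\<close>

lemma proj_tr_wd:
  assumes "\<And>m. mcoeff s m \<noteq> 0 \<Longrightarrow> supp m \<subseteq> V \<Longrightarrow> admissible (high (p ^ e) m) (high (p ^ e - 1) m)"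
    and "proj f = \<zero>"
  shows "proj (tr e (s * f)) = \<zero>"
proof -
  have "supp r \<notin> \<Delta>" if "mcoeff (tr e (s * f)) r \<noteq> 0" for r
  proof
    assume r: "supp r \<in> \<Delta>"
    from that have "mcoeff (s * f) (expo_scale (p ^ e) r + corner (p ^ e)) \<noteq> 0"
      by (auto simp: mcoeff_tr)
    then obtain a b where ab: "a + b = expo_scale (p ^ e) r + corner (p ^ e)" "mcoeff s a \<noteq> 0"
        "mcoeff f b \<noteq> 0"
      by (metis mcoeff_mult_nonzero)
    note exponent = trace_exponent[OF ab(1) pow_pos]
    have V: "supp a \<subseteq> V" "supp b \<subseteq> V"
      using exponent(1) face_subset[OF r] by blast+
    have "supp b \<notin> \<Delta>" using assms(2) ab(3) by (simp add: proj_eq_0_iff)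
    with assms(1)[OF ab(2) V(1)] V(2)
    have "high (p ^ e) a \<union> (high (p ^ e - 1) a \<inter> supp b) \<notin> \<Delta>"
      by (simp add: admissible_def)
    moreover have "high (p ^ e) a \<union> (high (p ^ e - 1) a \<inter> supp b) \<subseteq> supp r"
      using exponent(2,3) by blast
    ultimately show False using r face_down by blast
  qed
  then show ?thesis by (simp add: proj_eq_0_iff)
qed

text \<open>Testing against the smallest exponent \<open>b\<close> that contains \<open>N\<close> and makes \<open>m + b\<close>
  contribute to the trace.\<close>

lemma tr_exponent_nonface:
  assumes "\<And>f. (\<And>b. mcoeff f b \<noteq> 0 \<Longrightarrow> N \<subseteq> supp b) \<Longrightarrow> proj (tr e (s * f)) = \<zero>"
    and m: "mcoeff s m \<noteq> 0" "supp m \<subseteq> V" and N: "N \<subseteq> V"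
  shows "high (p ^ e) m \<union> (high (p ^ e - 1) m \<inter> N) \<notin> \<Delta>"
proof -
  let ?q = "p ^ e"
  \<comment> \<open>\<open>m + b\<close> rounds \<open>?k\<close> up to the next number that is
    \<open>q - 1\<close> modulo \<open>q\<close>; the extra 1 on \<open>N\<close> makes
    \<open>b\<close> positive there.\<close>
  let ?k = "\<lambda>i. expo_at m i + (if i \<in> N then 1 else 0)"
  define r where "r = expo_on V (\<lambda>i. ?k i div ?q)"
  define b where "b = expo_on V (\<lambda>i. ?q * (?k i div ?q) + (?q - 1) - expo_at m i)"
  have le: "?k i \<le> ?q * (?k i div ?q) + (?q - 1)" for i
  proof -
    have "?k i mod ?q \<le> ?q - 1" using mod_less_divisor[OF pow_pos, of "?k i" e] by linarith
    then show ?thesis using mult_div_mod_eq[of ?q "?k i"] by linarith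
  qed
  have r_supp: "supp r = high ?q m \<union> (high (?q - 1) m \<inter> N)"
  proof -
    have "?k i div ?q \<noteq> 0 \<longleftrightarrow> ?q \<le> ?k i" for i
      using pow_pos[of e] by (simp add: div_eq_0_iff not_less del: p_pos)
    then show ?thesis
      using N by (auto simp: r_def supp_expo_on finite_V high_def split: if_splits)
  qed
  have "b + m = expo_scale ?q r + corner ?q"
  proof (rule expo_eqI)
    fix i
    have "expo_at m i = 0" if "i \<notin> V" using m(2) that by (auto simp: in_keys_iff)
    then show "expo_at (b + m) i = expo_at (expo_scale ?q r + corner ?q) i"
      using le[of i] by (auto simp: lookup_add b_def r_def finite_V split: if_splits)
  qed
  moreover obtain c where "(\<tau> ^^ e) (mcoeff s m * c) \<noteq> 0" using \<tau>_pow_nonzero[OF m(1)] .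
  ultimately have "mcoeff (tr e (s * mmonom b c)) r \<noteq> 0"
    by (simp add: mcoeff_tr mult.commute[of s] mult.commute[of c] flip: \<open>b + m = _\<close>)
  moreover have "N \<subseteq> supp b"
  proof
    fix i assume "i \<in> N"
    then show "i \<in> supp b" using le[of i] N by (auto simp: b_def supp_expo_on finite_V)
  qed
  then have "proj (tr e (s * mmonom b c)) = \<zero>"
    by (intro assms(1)) (simp add: mcoeff_mmonom split: if_splits)
  ultimately have "supp r \<notin> \<Delta>" by (auto simp: proj_eq_0_iff)
  then show ?thesis by (simp add: r_supp)
qed

text \<open>A relation, because \<open>s\<close> may be changed at monomials that act trivially.
  Extensionality matches the maps in \<open>cartier_hom\<close> and makes \<open>\<phi>\<close>
  unique for given \<open>s\<close>.\<close>

definition represents :: "nat \<Rightarrow> 'k mps \<Rightarrow> ('r \<Rightarrow> 'r) \<Rightarrow> bool" where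
  "represents e s \<phi> \<longleftrightarrow> \<phi> \<in> extensional (carrier R) \<and> (\<forall>f. \<phi> (proj f) = proj (tr e (s * f)))"

lemma representsI:
  "\<phi> \<in> extensional (carrier R) \<Longrightarrow> (\<And>f. \<phi> (proj f) = proj (tr e (s * f))) \<Longrightarrow> represents e s \<phi>"
  by (simp add: represents_def)

lemma representsD: "represents e s \<phi> \<Longrightarrow> \<phi> (proj f) = proj (tr e (s * f))"
  by (simp add: represents_def)

lemma represents_unique:
  assumes "represents e s \<phi>" "represents e s \<psi>" shows "\<phi> = \<psi>"
proof (rule extensionalityI[of _ "carrier R"])
  fix x assume "x \<in> carrier R"
  then show "\<phi> x = \<psi> x" using assms by (metis proj_cases representsD)
qed (use assms in \<open>simp_all add: represents_def\<close>)

lemma represents_cartier_hom: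
  assumes "represents e s \<phi>" shows "\<phi> \<in> cartier_hom p e R"
  unfolding cartier_hom_iff
proof (intro conjI ballI)
  show "\<phi> \<in> carrier R \<rightarrow>\<^sub>E carrier R"
    using assms by (auto simp: PiE_def represents_def elim: proj_cases)
  fix x y assume "x \<in> carrier R" "y \<in> carrier R"
  then obtain f g where fg: "x = proj f" "y = proj g" by (metis proj_cases)
  show "\<phi> (x \<oplus> y) = \<phi> x \<oplus> \<phi> y"
    by (simp add: fg representsD[OF assms] distrib_left tr_add flip: proj_add)
  show "\<phi> (x [^] (p ^ e) \<otimes> y) = x \<otimes> \<phi> y"
    by (simp add: fg representsD[OF assms] mult.left_commute[of s] tr_frobenius flip: proj_mult proj_power)
qed

text \<open>The lift \<open>s\<close> is read off the values of \<open>\<phi>\<close> on a basis over the ring of \<open>q\<close>-th powers, using the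
  dual basis for the trace.\<close>

lemma cartier_hom_represents:
  assumes \<phi>: "\<phi> \<in> cartier_hom p e R"
  obtains s where "represents e s \<phi>"
proof -
  let ?q = "p ^ e"
  from tr_dual[of e] obtain J :: "(nat \<times> expo) set" and Y Z where J: "finite J"
    and dual: "\<forall>f m. supp m \<subseteq> V \<longrightarrow> mcoeff (\<Sum>j\<in>J. tr e (f * Y j) ^ ?q * Z j) m = mcoeff f m"
    by blast
  have "\<forall>j. \<exists>c. \<phi> (proj (Z j)) = proj c"
    using cartier_hom_closed[OF \<phi>] by (metis proj_cases proj_closed)
  then obtain c where c: "\<And>j. \<phi> (proj (Z j)) = proj (c j)" by metis
  have sum: "\<phi> (proj (\<Sum>j\<in>A. g j ^ ?q * Z j)) = proj (\<Sum>j\<in>A. g j * c j)" if "finite A" for A g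
    using that
  proof (induction A rule: finite_induct)
    case empty
    then show ?case by (simp add: cartier_hom_zero[OF \<phi>])
  next
    case (insert j A)
    then show ?case
      by (simp add: proj_add proj_mult proj_power cartier_hom_add[OF \<phi>] cartier_hom_smult[OF \<phi>] c)
  qed
  define s where "s = (\<Sum>j\<in>J. c j ^ ?q * Y j)"
  have "\<phi> (proj f) = proj (tr e (s * f))" for f
  proof -
    \<comment> \<open>The dual basis recovers the coefficients at monomials in \<open>V\<close>; all
      other monomials lie in the kernel.\<close>
    have "proj f = proj (\<Sum>j\<in>J. tr e (f * Y j) ^ ?q * Z j)"
      using dual by (intro proj_eqI) (auto simp: proj_eq_0_iff dest: face_subset)
    then have "\<phi> (proj f) = proj (\<Sum>j\<in>J. tr e (f * Y j) * c j)" by (simp add: sum[OF J])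
    also have "(\<Sum>j\<in>J. tr e (f * Y j) * c j) = tr e (s * f)"
      by (simp add: s_def sum_distrib_right tr_sum mult.assoc tr_frobenius)
         (simp add: mult.commute)
    finally show ?thesis .
  qed
  moreover have "\<phi> \<in> extensional (carrier R)" using \<phi> by (auto simp: cartier_hom_iff PiE_def)
  ultimately show thesis using that by (metis representsI)
qed

text \<open>Necessity in Fedder's criterion: a series whose monomials all involve a nonface
  \<open>N\<close> is zero in \<open>R\<close>, so \<open>\<phi>\<close> sends it to zero.\<close>

lemma represents_admissible:
  assumes "represents e s \<phi>" "mcoeff s m \<noteq> 0" "supp m \<subseteq> V"
  shows "admissible (high (p ^ e) m) (high (p ^ e - 1) m)"
proof -
  have "high (p ^ e) m \<union> (high (p ^ e - 1) m \<inter> N) \<notin> \<Delta>" if N: "N \<subseteq> V" "N \<notin> \<Delta>" for N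
  proof (rule tr_exponent_nonface[OF _ assms(2,3) N(1)])
    fix f :: "'k mps"
    assume "\<And>b. mcoeff f b \<noteq> 0 \<Longrightarrow> N \<subseteq> supp b"
    then have "proj f = \<zero>" using N(2) face_down by (auto simp: proj_eq_0_iff)
    then show "proj (tr e (s * f)) = \<zero>"
      using representsD[OF assms(1), of f] representsD[OF assms(1), of 0] by simp
  qed
  then show ?thesis by (auto simp: admissible_def high_def)
qed

text \<open>The lift is unique up to monomials that act trivially: \<open>s - t\<close> induces the
  zero map, and the test with \<open>N = {}\<close> applies.\<close>

lemma represents_diff:
  assumes "represents e s \<phi>" "represents e t \<phi>" "mcoeff s m \<noteq> mcoeff t m" "supp m \<subseteq> V"
  shows "high (p ^ e) m \<notin> \<Delta>"
proof -
  have "proj (tr e ((s - t) * f)) = \<zero>" for f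
  proof -
    have "proj (tr e (s * f)) = proj (tr e (t * f))"
      using representsD[OF assms(1), of f] representsD[OF assms(2), of f] by simp
    then show ?thesis
      by (simp add: left_diff_distrib tr_diff)
         (metis proj_add proj_uminus proj_closed r_neg uminus_add_conv_diff add.commute)
  qed
  from tr_exponent_nonface[OF this, of m "{}"] assms(3,4) show ?thesis by simp
qed

text \<open>The map is computed on a chosen preimage; admissibility makes the choice
  immaterial.\<close>

lemma represents_exists:
  assumes "\<And>m. mcoeff s m \<noteq> 0 \<Longrightarrow> supp m \<subseteq> V \<Longrightarrow> admissible (high (p ^ e) m) (high (p ^ e - 1) m)"
  obtains \<phi> where "represents e s \<phi>"
proof -
  let ?\<phi> = "\<lambda>x\<in>carrier R. proj (tr e (s * (SOME f. proj f = x)))"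
  have "?\<phi> (proj f) = proj (tr e (s * f))" for f
  proof -
    let ?g = "SOME g. proj g = proj f"
    have "proj ?g = proj f" by (rule someI[of _ f]) simp
    then have "proj (?g - f) = \<zero>"
      using proj_add[of ?g "- f"] by (simp add: proj_uminus r_neg)
    from proj_tr_wd[OF assms this] have "proj (tr e (s * ?g)) = proj (tr e (s * f))"
      by (intro proj_eqI) (simp add: tr_diff right_diff_distrib)
    then show ?thesis by simp
  qed
  then have "represents e s ?\<phi>" by (intro representsI) auto
  then show thesis by (rule that)
qed

text \<open>The factor \<open>s\<close> enters the inner trace as its \<open>p^b\<close>-th power,
  after which the two traces merge.\<close>

lemma represents_comp:
  assumes "represents a s \<phi>" "represents b t \<psi>"
  shows "represents (a + b) (s ^ (p ^ b) * t) (\<lambda>x\<in>carrier R. \<phi> (\<psi> x))"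
  by (rule representsI)
     (simp_all add: representsD[OF assms(1)] representsD[OF assms(2)] mult.assoc flip: tr_tr tr_frobenius)

lemma represents_add:
  assumes "represents e s \<phi>" "represents e t \<psi>"
  shows "represents e (s + t) (\<lambda>x\<in>carrier R. \<phi> x \<oplus> \<psi> x)"
  by (rule representsI)
     (simp_all add: representsD[OF assms(1)] representsD[OF assms(2)] distrib_right tr_add flip: proj_add)

lemma represents_zero: "represents e 0 (zero_map R)"
  by (rule representsI) (simp_all add: zero_map_def)

lemma represents_sum:
  assumes "finite A" "\<And>a. a \<in> A \<Longrightarrow> represents e (s a) (\<phi> a)"
  shows "represents e (\<Sum>a\<in>A. s a) (\<lambda>x\<in>carrier R. \<Oplus>a\<in>A. \<phi> a x)"
proof (rule representsI)
  fix f
  have "(\<Oplus>a\<in>A. \<phi> a (proj f)) = proj (tr e ((\<Sum>a\<in>A. s a) * f))"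
    using assms
  proof (induction A rule: finite_induct)
    case (insert a A)
    have "\<phi> b (proj f) \<in> carrier R" if "b \<in> insert a A" for b
      using representsD[OF insert.prems[OF that]] by simp
    with insert have "(\<Oplus>a\<in>insert a A. \<phi> a (proj f)) = \<phi> a (proj f) \<oplus> (\<Oplus>a\<in>A. \<phi> a (proj f))"
      by (intro finsum_insert) auto
    with insert show ?case
      by (simp add: representsD[of e "s a"] distrib_right tr_add proj_add)
  qed simp
  then show "(\<lambda>x\<in>carrier R. \<Oplus>a\<in>A. \<phi> a x) (proj f) = proj (tr e ((\<Sum>a\<in>A. s a) * f))" by simp
qed simp

end

section \<open>Homogeneous elements of the Cartier algebra\<close>

definition homogeneous :: "('a, 'r) ring_scheme \<Rightarrow> nat \<Rightarrow> ('a \<Rightarrow> 'a) \<Rightarrow> nat \<Rightarrow> 'a \<Rightarrow> 'a" where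
  "homogeneous R e \<phi> = (\<lambda>k. if k = e then \<phi> else zero_map R)"

context cring
begin

lemma cartier_algebra_component:
  "\<Phi> \<in> carrier (cartier_algebra p R) \<Longrightarrow> \<Phi> e \<in> cartier_hom p e R"
  by (simp add: cartier_algebra_def)

lemma homogeneous_closed:
  assumes "\<phi> \<in> cartier_hom p e R"
  shows "homogeneous R e \<phi> \<in> carrier (cartier_algebra p R)"
proof -
  have "{k. homogeneous R e \<phi> k \<noteq> zero_map R} \<subseteq> {e}" by (auto simp: homogeneous_def)
  then have "finite {k. homogeneous R e \<phi> k \<noteq> zero_map R}" by (rule finite_subset) simp
  then show ?thesis
    using assms by (simp add: cartier_algebra_def homogeneous_def zero_map_cartier_hom)
qed

lemma homogeneous_mult:
  assumes "\<phi> \<in> cartier_hom p a R" "\<psi> \<in> cartier_hom p b R"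
  shows "homogeneous R a \<phi> \<otimes>\<^bsub>cartier_algebra p R\<^esub> homogeneous R b \<psi> =
    homogeneous R (a + b) (\<lambda>x\<in>carrier R. \<phi> (\<psi> x))"
proof
  fix g
  have "(\<Oplus>e\<in>{..g}. homogeneous R a \<phi> e (homogeneous R b \<psi> (g - e) x)) =
      (if g = a + b then \<phi> (\<psi> x) else \<zero>)" if x: "x \<in> carrier R" for x
  proof -
    have c: "\<psi> x \<in> carrier R" "\<phi> (\<psi> x) \<in> carrier R"
      using cartier_hom_closed[OF assms(2) x] cartier_hom_closed[OF assms(1)] by auto
    have "(\<Oplus>e\<in>{..g}. homogeneous R a \<phi> e (homogeneous R b \<psi> (g - e) x)) =
        (\<Oplus>e\<in>{..g}. if a = e then (if g = a + b then \<phi> (\<psi> x) else \<zero>) else \<zero>)"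
    proof (rule finsum_cong')
      fix e assume "e \<in> {..g}"
      then show "homogeneous R a \<phi> e (homogeneous R b \<psi> (g - e) x) =
          (if a = e then (if g = a + b then \<phi> (\<psi> x) else \<zero>) else \<zero>)"
        using x c cartier_hom_zero[OF assms(1)]
        by (auto simp: homogeneous_def zero_map_def)
    qed (use c in auto)
    also have "\<dots> = (if g = a + b then \<phi> (\<psi> x) else \<zero>)"
    proof (cases "a \<le> g")
      case True
      then show ?thesis
        using finsum_singleton[of a "{..g}" "\<lambda>_. if g = a + b then \<phi> (\<psi> x) else \<zero>"] c
        by simp
    next
      case False
      then have "(\<Oplus>e\<in>{..g}. if a = e then (if g = a + b then \<phi> (\<psi> x) else \<zero>) else \<zero>) = (\<Oplus>e\<in>{..g}. \<zero>)"
        by (intro finsum_cong') auto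
      with False show ?thesis by simp
    qed
    finally show ?thesis .
  qed
  then show "(homogeneous R a \<phi> \<otimes>\<^bsub>cartier_algebra p R\<^esub> homogeneous R b \<psi>) g =
      homogeneous R (a + b) (\<lambda>x\<in>carrier R. \<phi> (\<psi> x)) g"
    by (auto simp: cartier_algebra_def homogeneous_def zero_map_def)
qed

lemma homogeneous_degree_zero:
  "\<phi> \<in> cartier_hom p 0 R \<Longrightarrow> homogeneous R 0 \<phi> \<in> cartier_degree_zero p R"
  using homogeneous_closed[of \<phi> p 0] by (simp add: cartier_degree_zero_def homogeneous_def)

text \<open>Every element is a finite sum of homogeneous ones; the induction removes one nonzero
  component at a time.\<close>

lemma cartier_algebra_generatedI:
  assumes "H \<subseteq> carrier (cartier_algebra p R)"
    and hom: "\<And>e \<phi>. \<phi> \<in> cartier_hom p e R \<Longrightarrow> homogeneous R e \<phi> \<in> generate_ring (cartier_algebra p R) H"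
  shows "generate_ring (cartier_algebra p R) H = carrier (cartier_algebra p R)"
proof
  let ?C = "cartier_algebra p R"
  interpret C: ring ?C by (rule cartier_algebra_ring)
  show "generate_ring ?C H \<subseteq> carrier ?C"
    using C.generate_ring_in_carrier assms(1) by blast
  show "carrier ?C \<subseteq> generate_ring ?C H"
  proof
    fix \<Phi> assume \<Phi>: "\<Phi> \<in> carrier ?C"
    then have "finite {e. \<Phi> e \<noteq> zero_map R}" by (simp add: cartier_algebra_def)
    then show "\<Phi> \<in> generate_ring ?C H"
      using \<Phi>
    proof (induction "{e. \<Phi> e \<noteq> zero_map R}" arbitrary: \<Phi> rule: finite_psubset_induct)
      case psubset
      show ?case
      proof (cases "{e. \<Phi> e \<noteq> zero_map R} = {}")
        case True
        then have "\<Phi> = homogeneous R 0 (zero_map R)" by (auto simp: homogeneous_def)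
        then show ?thesis using hom zero_map_cartier_hom by metis
      next
        case False
        then obtain e where e: "\<Phi> e \<noteq> zero_map R" by auto
        let ?\<Psi> = "\<Phi>(e := zero_map R)"
        have sub: "{k. ?\<Psi> k \<noteq> zero_map R} \<subset> {k. \<Phi> k \<noteq> zero_map R}" using e by auto
        moreover have "?\<Psi> \<in> carrier ?C"
          using psubset.prems psubset.hyps(1) sub
          by (auto simp: cartier_algebra_def zero_map_cartier_hom intro: finite_subset)
        ultimately have "?\<Psi> \<in> generate_ring ?C H" by (rule psubset.hyps(2))
        from generate_ring.eng_add[OF this hom[OF cartier_algebra_component[OF psubset.prems]]]
        have "?\<Psi> \<oplus>\<^bsub>?C\<^esub> homogeneous R e (\<Phi> e) \<in> generate_ring ?C H" .
        moreover have "?\<Psi> \<oplus>\<^bsub>?C\<^esub> homogeneous R e (\<Phi> e) = \<Phi>"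
        proof
          fix k
          have k: "\<Phi> k \<in> extensional (carrier R)" "\<And>x. x \<in> carrier R \<Longrightarrow> \<Phi> k x \<in> carrier R"
            using cartier_algebra_component[OF psubset.prems, of k] by (auto simp: cartier_hom_iff PiE_def)
          have "(?\<Psi> \<oplus>\<^bsub>?C\<^esub> homogeneous R e (\<Phi> e)) k =
              (\<lambda>x\<in>carrier R. ?\<Psi> k x \<oplus> homogeneous R e (\<Phi> e) k x)"
            by (simp add: cartier_algebra_def)
          also have "\<dots> = (\<lambda>x\<in>carrier R. \<Phi> k x)"
            using k(2) by (intro restrict_ext) (cases "k = e"; simp add: homogeneous_def zero_map_def)
          also have "\<dots> = \<Phi> k" by (rule extensional_restrict[OF k(1)])
          finally show "(?\<Psi> \<oplus>\<^bsub>?C\<^esub> homogeneous R e (\<Phi> e)) k = \<Phi> k" .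
        qed
        ultimately show ?thesis by simp
      qed
    qed
  qed
qed

end

section \<open>Free faces and admissible pairs\<close>

context face_ring
begin

lemma finite_faces: "finite \<Delta>"
  using face_subset finite_V by (meson Pow_iff finite_Pow_iff finite_subset subsetI)

lemma facet_above:
  assumes "A \<in> \<Delta>" obtains H where "facet \<Delta> H" "A \<subseteq> H"
proof -
  have "finite {H \<in> \<Delta>. A \<subseteq> H}" using finite_faces by simp
  then obtain H where "H \<in> {H \<in> \<Delta>. A \<subseteq> H}" "\<And>G. G \<in> {H \<in> \<Delta>. A \<subseteq> H} \<Longrightarrow> H \<subseteq> G \<Longrightarrow> H = G"
    using assms finite_has_maximal[of "{H \<in> \<Delta>. A \<subseteq> H}"] by auto
  then show thesis by (intro that[of H]) (auto simp: facet_def)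
qed

text \<open>An admissible pair \<open>(A, B)\<close> with \<open>i \<notin> B\<close> makes every facet containing \<open>A\<close> contain \<open>i\<close>.\<close>

lemma admissible_free_face:
  assumes AB: "admissible A B" and A: "A \<in> \<Delta>" and i: "i \<in> V" "i \<notin> B"
  shows "\<exists>F. free_face \<Delta> F"
proof -
  have cone: "i \<in> H" if H: "facet \<Delta> H" "A \<subseteq> H" for H
  proof (rule ccontr)
    assume "i \<notin> H"
    \<comment> \<open>Admissibility is tested on this nonface; as \<open>i \<notin> B\<close>, the
      set it declares a nonface lies in the face \<open>H\<close>.\<close>
    then have "insert i H \<notin> \<Delta>" using H(1) by (auto simp: facet_def)
    moreover have "insert i H \<subseteq> V" using H(1) i(1) face_subset by (auto simp: facet_def)
    ultimately have "A \<union> (B \<inter> insert i H) \<notin> \<Delta>" using AB by (simp add: admissible_def)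
    moreover have "A \<union> (B \<inter> insert i H) \<subseteq> H" using H(2) i(2) by blast
    ultimately show False using H(1) face_down by (auto simp: facet_def)
  qed
  obtain H where H: "facet \<Delta> H" "A \<subseteq> H" using facet_above[OF A] .
  have "H - {i} \<in> \<Delta>" using H(1) face_down[of H "H - {i}"] by (auto simp: facet_def)
  moreover have H_eq: "(H - {i}) \<union> {i} = H" using cone[OF H] by auto
  moreover have "G = H" if G: "facet \<Delta> G" "H - {i} \<subseteq> G" for G
  proof -
    have "A \<subseteq> G" using H(2) G(2) AB i(2) by (auto simp: admissible_def)
    then have "i \<in> G" using cone G(1) by blast
    then have "H \<subseteq> G" using G(2) by auto
    with G(1) H(1) show ?thesis by (auto simp: facet_def)
  qed
  ultimately have "free_face_at \<Delta> (H - {i}) i" using H(1) by (simp add: free_face_at_def)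
  then show ?thesis by (auto simp: free_face_def)
qed

text \<open>A facet above \<open>F\<close> and \<open>N - {i}\<close> can only be
  \<open>F \<union> {i}\<close>, and then \<open>N\<close> is contained in that face.\<close>

lemma free_face_admissible:
  assumes F: "free_face_at \<Delta> F i"
  shows "admissible F (V - {i})"
proof -
  have Fi: "F \<union> {i} \<in> \<Delta>" "i \<notin> F" using F by (auto simp: free_face_at_def facet_def)
  have "F \<union> ((V - {i}) \<inter> N) \<notin> \<Delta>" if N: "N \<subseteq> V" "N \<notin> \<Delta>" for N
  proof
    assume "F \<union> ((V - {i}) \<inter> N) \<in> \<Delta>"
    then obtain H where H: "facet \<Delta> H" "F \<union> ((V - {i}) \<inter> N) \<subseteq> H" by (rule facet_above)
    then have "H = F \<union> {i}" using F by (auto simp: free_face_at_def)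
    then have "N \<subseteq> F \<union> {i}" using H(2) N(1) by auto
    then show False using Fi N(2) face_down by blast
  qed
  then show ?thesis using Fi face_subset by (auto simp: admissible_def)
qed

section \<open>Principal generation in the absence of free faces\<close>

lemma tr_degree_0: "tr 0 f = f"
proof (rule mps_eqI)
  fix r
  have "expo_scale 1 r + corner 1 = r" by (rule expo_eqI) (simp add: lookup_add)
  then show "mcoeff (tr 0 f) r = mcoeff f r" by (simp add: mcoeff_tr)
qed

lemma represents_degree_0: "represents 0 g (\<lambda>x\<in>carrier R. proj g \<otimes> x)"
  by (rule representsI) (simp_all add: tr_degree_0 proj_mult)

lemma represents_corner_multiple:
  assumes no_free: "\<nexists>F. free_face \<Delta> F" and s: "represents e s \<phi>"
  obtains g where "represents e (mmonom (corner (p ^ e)) 1 * g) \<phi>"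
proof -
  define g where "g = Mps (\<lambda>m. mcoeff s (corner (p ^ e) + m))"
  let ?t = "mmonom (corner (p ^ e)) 1 * g"
  have "high (p ^ e) m \<notin> \<Delta>" if m: "mcoeff (s - ?t) m \<noteq> 0" "supp m \<subseteq> V" for m
  proof
    assume A: "high (p ^ e) m \<in> \<Delta>"
    have no_split: "\<nexists>l. m = corner (p ^ e) + l" using m(1) by (auto simp: g_def)
    then have "mcoeff ?t m = 0" by (intro mcoeff_mmonom_mult_eq_0) auto
    then have "mcoeff s m \<noteq> 0" using m(1) by simp
    then have "admissible (high (p ^ e) m) (high (p ^ e - 1) m)"
      using represents_admissible[OF s] m(2) by blast
    moreover have "\<exists>i. \<not> expo_at (corner (p ^ e)) i \<le> expo_at m i"
      using no_split expo_splitI by blast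
    then obtain i where "i \<in> V" "i \<notin> high (p ^ e - 1) m"
      by (auto simp: high_def split: if_splits)
    ultimately show False using admissible_free_face A no_free by blast
  qed
  then have "proj (tr e ((s - ?t) * f)) = \<zero>" for f by (rule proj_tr_eq_0I)
  then have "proj (tr e (s * f)) = proj (tr e (?t * f))" for f
    by (intro proj_eqI) (simp add: left_diff_distrib tr_diff)
  then have "represents e ?t \<phi>" using s by (simp add: represents_def)
  then show thesis by (rule that)
qed

theorem principally_generated_if_no_free_face:
  assumes no_free: "\<nexists>F. free_face \<Delta> F"
  shows "cartier_principally_generated p R"
proof -
  let ?C = "cartier_algebra p R"
  \<comment> \<open>The pair is \<open>({}, V)\<close>, admissible for every complex because
    \<open>V \<inter> N = N\<close>.\<close>
  have "admissible (high (p ^ 1) m) (high (p ^ 1 - 1) m)"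
    if "mcoeff (mmonom (corner p) (1 :: 'k)) m \<noteq> 0" for m
  proof -
    have "m = corner p" using that by (simp add: mcoeff_mmonom split: if_splits)
    then have "high (p ^ 1) m = {}" "high (p ^ 1 - 1) m = V" using p_ge_2 by (auto simp: high_def)
    then show ?thesis by (auto simp: admissible_def Int_absorb1)
  qed
  then obtain \<phi>1 where \<phi>1: "represents 1 (mmonom (corner p) 1) \<phi>1"
    using represents_exists[of "mmonom (corner p) 1" 1] by metis
  let ?\<Gamma> = "homogeneous R 1 \<phi>1"
  let ?H = "cartier_degree_zero p R \<union> {?\<Gamma>}"
  have \<Gamma>: "?\<Gamma> \<in> carrier ?C" by (rule homogeneous_closed[OF represents_cartier_hom[OF \<phi>1]])
  \<comment> \<open>The \<open>e\<close>-fold product of the generator is represented by the corner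
    monomial for \<open>p^e\<close>, since
    \<open>p^e (p - 1) + (p^e - 1) = p^(e+1) - 1\<close>.\<close>
  have power: "\<exists>\<phi>. represents e (mmonom (corner (p ^ e)) 1) \<phi> \<and> homogeneous R e \<phi> \<in> generate_ring ?C ?H" for e
  proof (induction e)
    case 0
    have "corner (p ^ 0) = 0" by (rule expo_eqI) simp
    then have rep: "represents 0 (mmonom (corner (p ^ 0)) 1) (\<lambda>x\<in>carrier R. proj 1 \<otimes> x)"
      using represents_degree_0[of 1] by (simp add: mmonom_0_1)
    then have "homogeneous R 0 (\<lambda>x\<in>carrier R. proj 1 \<otimes> x) \<in> ?H"
      using homogeneous_degree_zero represents_cartier_hom by blast
    then show ?case using rep generate_ring.incl by metis
  next
    case (Suc e)
    then obtain \<phi> where \<phi>: "represents e (mmonom (corner (p ^ e)) 1) \<phi>"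
      "homogeneous R e \<phi> \<in> generate_ring ?C ?H" by auto
    have "expo_scale (p ^ e) (corner p) + corner (p ^ e) = corner (p ^ Suc e)"
    proof (rule expo_eqI)
      have "(1::nat) \<le> p" "1 \<le> p ^ e" using pow_pos[of e] p_ge_2 by linarith+
      then show "expo_at (expo_scale (p ^ e) (corner p) + corner (p ^ e)) i = expo_at (corner (p ^ Suc e)) i" for i
        by (simp add: lookup_add diff_mult_distrib2 mult.commute)
    qed
    then have "represents (Suc e) (mmonom (corner (p ^ Suc e)) 1) (\<lambda>x\<in>carrier R. \<phi>1 (\<phi> x))"
      using represents_comp[OF \<phi>1 \<phi>(1)] by (simp add: mmonom_power mmonom_mult)
    moreover have "?\<Gamma> \<otimes>\<^bsub>?C\<^esub> homogeneous R e \<phi> \<in> generate_ring ?C ?H"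
      by (rule generate_ring.eng_mult[OF generate_ring.incl \<phi>(2)]) simp
    ultimately show ?case
      using homogeneous_mult[OF \<phi>1[THEN represents_cartier_hom] \<phi>(1)[THEN represents_cartier_hom]]
      by auto
  qed
  have "generate_ring ?C ?H = carrier ?C"
  proof (rule cartier_algebra_generatedI)
    show "?H \<subseteq> carrier ?C" using \<Gamma> by (auto simp: cartier_degree_zero_def)
    fix e \<phi> assume "\<phi> \<in> cartier_hom p e R"
    then obtain s where "represents e s \<phi>" by (rule cartier_hom_represents)
    then obtain g where g: "represents e (mmonom (corner (p ^ e)) 1 * g) \<phi>"
      by (rule represents_corner_multiple[OF no_free])
    obtain \<psi> where \<psi>: "represents e (mmonom (corner (p ^ e)) 1) \<psi>"
      "homogeneous R e \<psi> \<in> generate_ring ?C ?H" using power by blast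
    \<comment> \<open>The cofactor \<open>g\<close> of the corner monomial becomes multiplication by
      \<open>proj g\<close> before \<open>\<psi>\<close>, an element of degree 0.\<close>
    let ?\<mu> = "\<lambda>x\<in>carrier R. proj g \<otimes> x"
    have "\<phi> = (\<lambda>x\<in>carrier R. \<psi> (?\<mu> x))"
      using represents_comp[OF \<psi>(1) represents_degree_0, of g] by (intro represents_unique[OF g]) simp
    then have "homogeneous R e \<phi> = homogeneous R e \<psi> \<otimes>\<^bsub>?C\<^esub> homogeneous R 0 ?\<mu>"
      using homogeneous_mult[OF represents_cartier_hom[OF \<psi>(1)] represents_cartier_hom[OF represents_degree_0]]
      by simp
    moreover have "homogeneous R 0 ?\<mu> \<in> generate_ring ?C ?H"
      using homogeneous_degree_zero[OF represents_cartier_hom[OF represents_degree_0]]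
      by (intro generate_ring.incl) simp
    ultimately show "homogeneous R e \<phi> \<in> generate_ring ?C ?H"
      using \<psi>(2) by (metis generate_ring.eng_mult)
  qed
  with \<Gamma> show ?thesis unfolding cartier_principally_generated_def by blast
qed

end

section \<open>Infinite generation in the presence of a free face\<close>

text \<open>Fix an admissible pair \<open>(A, B)\<close> with \<open>i \<notin> B\<close> and \<open>A\<close> a face that is minimal with these
  properties.  The monomial with exponent \<open>q\<close> on \<open>A\<close> and \<open>q - 1\<close> on \<open>B - A\<close> represents a map of
  degree \<open>e\<close>, where \<open>q = p\<^sup>e\<close>, that involves no contribution from compositions of maps of
  smaller positive degree.\<close>

locale minimal_admissible = face_ring p \<tau> V R \<Delta> proj
  for p :: nat and \<tau> :: "'k::field \<Rightarrow> 'k" and V :: "nat set"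
    and R :: "('r, 'm) ring_scheme" (structure)
    and \<Delta> :: "nat set set" and proj :: "'k mps \<Rightarrow> 'r" +
  fixes A B N :: "nat set" and i :: nat
  assumes AB: "admissible A B" and A_face: "A \<in> \<Delta>" and i_B: "i \<notin> B"
    and minimal: "admissible A' B' \<Longrightarrow> A' \<subseteq> A \<Longrightarrow> B' \<subseteq> B \<Longrightarrow> A' = A \<and> B' = B"
    and N: "N \<subseteq> V" "N \<notin> \<Delta>" "i \<in> N" "N - {i} \<in> \<Delta>"
begin

definition special :: "nat \<Rightarrow> expo" where
  "special q = expo_on V (\<lambda>j. if j \<in> A then q else if j \<in> B then q - 1 else 0)"

lemma A_B: "A \<subseteq> B" "B \<subseteq> V"
  using AB by (auto simp: admissible_def)

lemma expo_at_special: "expo_at (special q) j = (if j \<in> A then q else if j \<in> B then q - 1 else 0)"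
  using A_B by (auto simp: special_def finite_V)

lemma high_special:
  assumes "q \<ge> 2" shows "high q (special q) = A" "high (q - 1) (special q) = B"
  using assms A_B by (auto simp: high_def expo_at_special split: if_splits)

lemma special_supp: "supp (special q) \<subseteq> V"
  by (auto simp: special_def supp_expo_on finite_V)

lemma pow_ge_2: "c > 0 \<Longrightarrow> p ^ c \<ge> 2"
  using p_ge_2 power_increasing[of 1 c p] by simp

text \<open>The bound confines the entries of \<open>k\<close> that are at least \<open>p^c\<close>
  to \<open>A\<close> and the nonzero ones to \<open>B\<close>; minimality of \<open>(A, B)\<close>
  turns the inclusions into equalities.\<close>

lemma divisor_type:
  assumes adm: "admissible (high (p ^ c) k) (high (p ^ c - 1) k)" and c: "c > 0"
    and le: "\<And>j. p ^ d * expo_at k j \<le> expo_at (special (p ^ (c + d))) j"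
  shows "high (p ^ c) k = A" "high (p ^ c - 1) k = B"
proof -
  have q: "p ^ (c + d) = p ^ d * p ^ c" by (simp add: power_add mult.commute)
  have pos: "p ^ d \<ge> 1" "p ^ c \<ge> 2" using pow_pos[of d] pow_ge_2[OF c] by linarith+
  have "j \<in> A" if "j \<in> high (p ^ c) k" for j
  proof -
    have "p ^ (c + d) \<le> p ^ d * expo_at k j" using that by (auto simp: q high_def)
    then have "p ^ (c + d) \<le> expo_at (special (p ^ (c + d))) j" using le[of j] by linarith
    moreover have "p ^ (c + d) \<ge> 2" using c by (intro pow_ge_2) simp
    ultimately show ?thesis by (auto simp: expo_at_special split: if_splits)
  qed
  moreover have "j \<in> B" if "j \<in> high (p ^ c - 1) k" for j
  proof -
    have "1 \<le> expo_at k j" using that pos(2) by (auto simp: high_def)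
    then have "1 * 1 \<le> p ^ d * expo_at k j" using pos(1) by (intro mult_le_mono)
    then have "1 \<le> expo_at (special (p ^ (c + d))) j" using le[of j] by linarith
    then show ?thesis using A_B by (auto simp: expo_at_special split: if_splits)
  qed
  ultimately show "high (p ^ c) k = A" "high (p ^ c - 1) k = B"
    using minimal[OF adm] by blast+
qed

lemma special_le:
  assumes "high q k = A" "high (q - 1) k = B"
  shows "expo_at (special q) j \<le> expo_at k j"
  using assms by (auto simp: expo_at_special high_def)

text \<open>Write the special exponent as \<open>p^b m + k\<close>. If \<open>a\<close> or
  \<open>b\<close> is 0, the factor of positive degree must be the special monomial itself, which
  \<open>s0\<close> and \<open>t0\<close> exclude. Otherwise \<open>m\<close> has type
  \<open>(A, B)\<close>, so \<open>k\<close> stays below \<open>p^b\<close> and vanishes at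
  \<open>i\<close>; admissibility of \<open>k\<close>, tested on \<open>N\<close>, then makes a
  subset of the face \<open>N - {i}\<close> a nonface.\<close>

lemma special_indecomposable:
  assumes s: "represents a s \<phi>" and t: "represents b t \<psi>" and e: "a + b > 0"
    and s0: "b = 0 \<Longrightarrow> mcoeff s (special (p ^ a)) = 0"
    and t0: "a = 0 \<Longrightarrow> mcoeff t (special (p ^ b)) = 0"
  shows "mcoeff (s ^ (p ^ b) * t) (special (p ^ (a + b))) = 0"
proof (rule ccontr)
  let ?u = "special (p ^ (a + b))"
  assume "mcoeff (s ^ (p ^ b) * t) ?u \<noteq> 0"
  then obtain sm k where "?u = sm + k" "mcoeff (s ^ (p ^ b)) sm \<noteq> 0" and k: "mcoeff t k \<noteq> 0"
    by (rule mcoeff_mult_nonzero)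
  moreover from this(2) obtain m where "sm = expo_scale (p ^ b) m" and m: "mcoeff s m \<noteq> 0"
    using mcoeff_frobenius_nonzero[OF CHAR prime_p] by metis
  ultimately have u: "?u = expo_scale (p ^ b) m + k" by simp
  have u_at: "expo_at ?u j = p ^ b * expo_at m j + expo_at k j" for j
    by (simp add: u lookup_add)
  have "supp m \<subseteq> V" "supp k \<subseteq> V"
  proof -
    have "j \<in> V" if "expo_at m j \<noteq> 0 \<or> expo_at k j \<noteq> 0" for j
    proof -
      have "expo_at ?u j \<noteq> 0" using that u_at[of j] by auto
      then show ?thesis using special_supp[of "p ^ (a + b)"] by (auto simp: in_keys_iff)
    qed
    then show "supp m \<subseteq> V" "supp k \<subseteq> V" by (auto simp: in_keys_iff)
  qed
  then have adm: "admissible (high (p ^ a) m) (high (p ^ a - 1) m)"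
      "admissible (high (p ^ b) k) (high (p ^ b - 1) k)"
    using represents_admissible s t m k by blast+
  show False
  proof (cases "a = 0")
    case True
    then have b: "b > 0" using e by simp
    have "p ^ 0 * expo_at k j \<le> expo_at (special (p ^ (b + 0))) j" for j
      using u_at[of j] True by simp
    note type = divisor_type[OF adm(2) b this]
    have "k = special (p ^ b)"
      using special_le[OF type] u_at True by (intro expo_eqI) (metis add_0 le_add2 le_antisym)
    then show False using t0 k True by simp
  next
    case False
    then have a: "a > 0" by simp
    have le: "p ^ b * expo_at m j \<le> expo_at ?u j" for j using u_at[of j] by simp
    note type = divisor_type[OF adm(1) a le]
    show False
    proof (cases "b = 0")
      case True
      have "m = special (p ^ a)"
        using special_le[OF type] u_at True
        by (intro expo_eqI) (metis add.right_neutral le_add1 le_antisym mult_1 power_0)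
      then show False using s0 m True by simp
    next
      case False
      then have b: "p ^ b \<ge> 2" by (intro pow_ge_2) simp
      have q: "p ^ (a + b) = p ^ b * p ^ a" by (simp add: power_add mult.commute)
      \<comment> \<open>What \<open>p^b m\<close> leaves for \<open>k\<close> is nothing on
        \<open>A\<close>, at most \<open>p^b - 1\<close> on the rest of \<open>B\<close>, and
        nothing outside \<open>B\<close>.\<close>
      have "expo_at k j < p ^ b" for j
      proof (rule ccontr)
        assume k_ge: "\<not> expo_at k j < p ^ b"
        have "p ^ b * (p ^ a - 1) \<le> p ^ b * expo_at m j" if "j \<in> B"
          using that type(2) by (intro mult_le_mono2) (auto simp: high_def)
        then have B: "p ^ (a + b) \<le> p ^ b * expo_at m j + p ^ b" if "j \<in> B"
          using that by (simp add: q diff_mult_distrib2)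
        have A: "p ^ (a + b) \<le> p ^ b * expo_at m j" if "j \<in> A"
          unfolding q using that type(1) by (intro mult_le_mono2) (auto simp: high_def)
        have "p ^ (a + b) > 0" by simp
        consider "j \<in> A" | "j \<in> B" "j \<notin> A" | "j \<notin> A" "j \<notin> B" by blast
        then show False
        proof cases
          case 1
          then have "expo_at ?u j = p ^ (a + b)" by (simp add: expo_at_special)
          with u_at[of j] A[OF 1] k_ge b show False by linarith
        next
          case 2
          then have "expo_at ?u j = p ^ (a + b) - 1" by (simp add: expo_at_special)
          with u_at[of j] B[OF 2(1)] k_ge \<open>p ^ (a + b) > 0\<close> show False by linarith
        next
          case 3
          then have "expo_at ?u j = 0" by (simp add: expo_at_special)
          with u_at[of j] k_ge b show False by linarith
        qed
      qed
      then have "high (p ^ b) k = {}" by (auto simp: high_def not_le)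
      with adm(2) N(1,2) have "high (p ^ b - 1) k \<inter> N \<notin> \<Delta>" by (auto simp: admissible_def)
      moreover have "expo_at ?u i = 0" using i_B A_B(1) by (auto simp: expo_at_special)
      then have "expo_at k i = 0" using u_at[of i] by simp
      then have "i \<notin> high (p ^ b - 1) k" using b by (auto simp: high_def)
      then have "high (p ^ b - 1) k \<inter> N \<subseteq> N - {i}" by blast
      ultimately show False using N(4) face_down by blast
    qed
  qed
qed

text \<open>In a positive degree \<open>e\<close> where \<open>\<Gamma>\<close> has no component,
  vanishing of the coefficient at the special monomial holds for the generators and survives all
  ring operations, yet the special monomial itself represents a map.\<close>

lemma not_principally_generated: "\<not> cartier_principally_generated p R"
proof
  let ?C = "cartier_algebra p R"
  interpret C: ring ?C by (rule cartier_algebra_ring)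
  assume "cartier_principally_generated p R"
  then obtain \<Gamma> where \<Gamma>: "\<Gamma> \<in> carrier ?C"
    and gen: "generate_ring ?C (cartier_degree_zero p R \<union> {\<Gamma>}) = carrier ?C"
    by (auto simp: cartier_principally_generated_def)
  have "finite (insert 0 {e. \<Gamma> e \<noteq> zero_map R})" using \<Gamma> by (simp add: cartier_algebra_def)
  from ex_new_if_finite[OF infinite_UNIV_nat this]
  obtain e where "e \<notin> insert 0 {e. \<Gamma> e \<noteq> zero_map R}" by blast
  then have e: "e > 0" "\<Gamma> e = zero_map R" by auto
  let ?u = "special (p ^ e)"
  define avoids where "avoids \<Phi> \<longleftrightarrow> (\<exists>s. represents e s (\<Phi> e) \<and> mcoeff s ?u = 0)" for \<Phi> :: "nat \<Rightarrow> 'r \<Rightarrow> 'r"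
  have avoids_0: "avoids \<Phi>" if "\<Phi> e = zero_map R" for \<Phi>
    using that represents_zero[of e] by (auto simp: avoids_def)
  \<comment> \<open>Since \<open>A\<close> is a face, the coefficient at \<open>?u\<close> does not
    depend on the lift, so the choice of \<open>s\<close> in \<open>avoids\<close> is
    harmless.\<close>
  have u_face: "mcoeff s ?u = mcoeff t ?u" if "represents e s \<phi>" "represents e t \<phi>" for s t \<phi>
    using represents_diff[OF that, of ?u] special_supp A_face high_special(1)[OF pow_ge_2[OF e(1)]] by auto
  have "\<Phi> \<in> carrier ?C \<and> avoids \<Phi>"
    if "\<Phi> \<in> generate_ring ?C (cartier_degree_zero p R \<union> {\<Gamma>})" for \<Phi>
    using that
  proof (induction rule: generate_ring.induct)
    case one
    have "\<one>\<^bsub>?C\<^esub> e = zero_map R" using e(1) by (simp add: cartier_algebra_def)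
    then show ?case using avoids_0 by simp
  next
    case (incl \<Phi>)
    then show ?case using \<Gamma> e by (auto intro!: avoids_0 simp: cartier_degree_zero_def)
  next
    case (a_inv \<Phi>)
    then obtain s where s: "represents e s (\<Phi> e)" "mcoeff s ?u = 0" by (auto simp: avoids_def)
    have closed: "\<ominus>\<^bsub>?C\<^esub> \<Phi> \<in> carrier ?C" using a_inv by simp
    obtain t where t: "represents e t ((\<ominus>\<^bsub>?C\<^esub> \<Phi>) e)"
      using cartier_hom_represents[OF cartier_algebra_component[OF closed]] .
    have "(\<lambda>x\<in>carrier R. (\<ominus>\<^bsub>?C\<^esub> \<Phi>) e x \<oplus> \<Phi> e x) = (\<ominus>\<^bsub>?C\<^esub> \<Phi> \<oplus>\<^bsub>?C\<^esub> \<Phi>) e"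
      by (simp add: cartier_algebra_def)
    also have "\<dots> = \<zero>\<^bsub>?C\<^esub> e" using a_inv by (simp add: C.l_neg)
    also have "\<dots> = zero_map R" by (simp add: cartier_algebra_def)
    finally have "represents e (t + s) (zero_map R)" using represents_add[OF t s(1)] by simp
    from u_face[OF this represents_zero] have "mcoeff t ?u = 0" using s(2) by simp
    with t closed show ?case by (auto simp: avoids_def)
  next
    case (eng_add \<Phi> \<Psi>)
    then obtain s t where s: "represents e s (\<Phi> e)" "mcoeff s ?u = 0"
      and t: "represents e t (\<Psi> e)" "mcoeff t ?u = 0" by (auto simp: avoids_def)
    have "(\<Phi> \<oplus>\<^bsub>?C\<^esub> \<Psi>) e = (\<lambda>x\<in>carrier R. \<Phi> e x \<oplus> \<Psi> e x)" by (simp add: cartier_algebra_def)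
    then have "avoids (\<Phi> \<oplus>\<^bsub>?C\<^esub> \<Psi>)"
      unfolding avoids_def using represents_add[OF s(1) t(1)] s(2) t(2)
      by (intro exI[of _ "s + t"]) simp
    then show ?case using eng_add by simp
  next
    case (eng_mult \<Phi> \<Psi>)
    \<comment> \<open>The coefficient condition serves the terms \<open>k = 0\<close> and
      \<open>k = e\<close> of the product, where one factor has degree 0.\<close>
    have choice: "\<exists>s. \<forall>k. represents k (s k) (X k) \<and> (k = e \<longrightarrow> mcoeff (s k) ?u = 0)"
      if X: "X \<in> carrier ?C" "avoids X" for X
    proof (rule choice, rule allI)
      fix k
      obtain s where "represents k s (X k)"
        using cartier_hom_represents[OF cartier_algebra_component[OF X(1)]] .
      then show "\<exists>s. represents k s (X k) \<and> (k = e \<longrightarrow> mcoeff s ?u = 0)"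
        using X(2) by (cases "k = e") (auto simp: avoids_def)
    qed
    from choice eng_mult obtain s where
      s: "\<And>k. represents k (s k) (\<Phi> k)" "mcoeff (s e) ?u = 0" by metis
    from choice eng_mult obtain t where
      t: "\<And>k. represents k (t k) (\<Psi> k)" "mcoeff (t e) ?u = 0" by metis
    let ?w = "\<lambda>k. s k ^ (p ^ (e - k)) * t (e - k)"
    let ?\<chi> = "\<lambda>k. \<lambda>x\<in>carrier R. \<Phi> k (\<Psi> (e - k) x)"
    have rep: "represents e (?w k) (?\<chi> k)" if "k \<in> {..e}" for k
      using represents_comp[OF s(1) t(1), of k "e - k"] that by simp
    have "(\<Phi> \<otimes>\<^bsub>?C\<^esub> \<Psi>) e = (\<lambda>x\<in>carrier R. \<Oplus>k\<in>{..e}. ?\<chi> k x)"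
      using cartier_hom_closed[OF represents_cartier_hom[OF s(1)]]
        cartier_hom_closed[OF represents_cartier_hom[OF t(1)]]
      by (auto simp: cartier_algebra_def intro!: restrict_ext finsum_cong')
    then have "represents e (\<Sum>k\<le>e. ?w k) ((\<Phi> \<otimes>\<^bsub>?C\<^esub> \<Psi>) e)"
      using represents_sum[of "{..e}" e ?w ?\<chi>] rep by simp
    moreover have "mcoeff (?w k) ?u = 0" if "k \<le> e" for k
      using special_indecomposable[OF s(1) t(1), of k "e - k"] that e(1) s(2) t(2) by force
    then have "mcoeff (\<Sum>k\<le>e. ?w k) ?u = 0" by (simp add: mcoeff_sum)
    ultimately show ?case using eng_mult by (auto simp: avoids_def)
  qed
  then have all: "avoids \<Phi>" if "\<Phi> \<in> carrier ?C" for \<Phi> using that gen by blast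
  have q: "p ^ e \<ge> 2" using e(1) by (rule pow_ge_2)
  have "admissible (high (p ^ e) m) (high (p ^ e - 1) m)" if "mcoeff (mmonom ?u (1::'k)) m \<noteq> 0" for m
    using that AB high_special[OF q] by (auto simp: mcoeff_mmonom split: if_splits)
  then obtain \<phi> where \<phi>: "represents e (mmonom ?u 1) \<phi>"
    using represents_exists by metis
  then have "avoids (homogeneous R e \<phi>)"
    by (intro all homogeneous_closed represents_cartier_hom)
  then obtain s where "represents e s \<phi>" "mcoeff s ?u = 0"
    by (auto simp: avoids_def homogeneous_def)
  with u_face[OF \<phi> this(1)] show False by (simp add: mcoeff_mmonom)
qed

end

text \<open>Among the admissible pairs with \<open>A\<close> a face and \<open>i \<notin> B\<close>,
  one with least \<open>card A + card B\<close> is minimal for inclusion, because both conditions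
  pass to smaller pairs.\<close>

theorem (in face_ring) no_free_face_if_principally_generated:
  assumes pg: "cartier_principally_generated p R"
    and no_cone: "\<And>i. i \<in> V \<Longrightarrow> \<exists>N\<subseteq>V. N \<notin> \<Delta> \<and> i \<in> N \<and> N - {i} \<in> \<Delta>"
  shows "\<nexists>F. free_face \<Delta> F"
proof
  assume "\<exists>F. free_face \<Delta> F"
  then obtain F i where F: "free_face_at \<Delta> F i" by (auto simp: free_face_def)
  then have i: "i \<in> V" and F_face: "F \<in> \<Delta>"
    using face_subset by (auto simp: free_face_at_def facet_def)
  from no_cone[OF i] obtain N where N: "N \<subseteq> V" "N \<notin> \<Delta>" "i \<in> N" "N - {i} \<in> \<Delta>" by auto
  let ?P = "\<lambda>(A, B). admissible A B \<and> A \<in> \<Delta> \<and> i \<notin> B"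
  let ?m = "\<lambda>(A, B). card A + card B"
  have "?P (F, V - {i})" using free_face_admissible[OF F] F_face by simp
  from ex_has_least_nat[of ?P, OF this, of ?m] obtain A B where
    AB: "admissible A B" "A \<in> \<Delta>" "i \<notin> B"
    and least: "\<And>A' B'. admissible A' B' \<Longrightarrow> A' \<in> \<Delta> \<Longrightarrow> i \<notin> B' \<Longrightarrow> card A + card B \<le> card A' + card B'"
    by fastforce
  have "A' = A \<and> B' = B" if "admissible A' B'" "A' \<subseteq> A" "B' \<subseteq> B" for A' B'
  proof -
    have fin: "finite A" "finite B"
      using AB(1) finite_V by (auto simp: admissible_def intro: finite_subset)
    have "card A + card B \<le> card A' + card B'"
      using that AB by (intro least) (auto intro: face_down)
    moreover have "card A' \<le> card A" "card B' \<le> card B"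
      using that fin by (auto intro: card_mono)
    ultimately have "card A' = card A" "card B' = card B" by linarith+
    then show ?thesis using that fin by (simp add: card_subset_eq)
  qed
  then interpret minimal_admissible p \<tau> V R \<Delta> proj A B N i
    using AB N by unfold_locales auto
  show False using not_principally_generated pg by simp
qed

section \<open>Stanley-Reisner ideals\<close>

lemma pseries_ring_carrier:
  "f \<in> carrier (pseries_ring V) \<longleftrightarrow> (\<forall>m. f m \<noteq> 0 \<longrightarrow> supp m \<subseteq> V)"
  by (simp add: pseries_ring_def)

lemma pseries_ring_simps:
  "f \<oplus>\<^bsub>pseries_ring V\<^esub> g = (\<lambda>m. f m + g m)"
  "f \<otimes>\<^bsub>pseries_ring V\<^esub> g = mcoeff (Mps f * Mps g)"
  "\<zero>\<^bsub>pseries_ring V\<^esub> = (\<lambda>m. 0)"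
  "\<one>\<^bsub>pseries_ring V\<^esub> = mcoeff 1"
  by (simp_all add: pseries_ring_def times_mps_def one_mps_def)

lemma pseries_ring_uminus:
  assumes "f \<in> carrier (pseries_ring V)"
  shows "\<ominus>\<^bsub>pseries_ring V\<^esub> f = (\<lambda>m. - f m)"
proof -
  interpret S: cring "pseries_ring V :: (expo \<Rightarrow> 'a) ring" by (rule pseries_ring_cring)
  show ?thesis
    using assms
    by (intro S.minus_equality) (auto simp: pseries_ring_simps pseries_ring_carrier)
qed

lemma pseries_monom_eq: "pseries_monom m = mcoeff (mmonom m 1)"
  by (simp add: pseries_monom_def mmonom_def)

lemma Mps_pseries_monom [simp]: "Mps (pseries_monom m) = mmonom m 1"
  by (simp add: pseries_monom_eq mcoeff_inverse)

lemma pseries_monom_carrier: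
  "(pseries_monom m :: expo \<Rightarrow> 'k::comm_ring_1) \<in> carrier (pseries_ring V) \<longleftrightarrow> supp m \<subseteq> V"
  by (auto simp: pseries_ring_carrier pseries_monom_def)

lemma pseries_monom_nonzero: "(pseries_monom m :: expo \<Rightarrow> 'k::comm_ring_1) k \<noteq> 0 \<longleftrightarrow> k = m"
  by (simp add: pseries_monom_def)

lemma pseries_monom_inject: "(pseries_monom k :: expo \<Rightarrow> 'k::comm_ring_1) = pseries_monom l \<longleftrightarrow> k = l"
  by (auto simp: pseries_monom_def fun_eq_iff split: if_splits)

lemma pseries_monom_mult:
  "pseries_monom k \<otimes>\<^bsub>pseries_ring V\<^esub> pseries_monom l = pseries_monom (k + l)"
  by (simp add: pseries_ring_simps mmonom_mult) (simp add: pseries_monom_eq)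

lemma pseries_monomial_ideal:
  assumes up: "\<And>k l. P k \<Longrightarrow> P (k + l)"
  shows "ideal {f \<in> carrier (pseries_ring V). \<forall>m. f m \<noteq> (0::'k::comm_ring_1) \<longrightarrow> P m} (pseries_ring V)"
    (is "ideal ?I ?S")
proof -
  interpret S: cring ?S by (rule pseries_ring_cring)
  show ?thesis
  proof (rule idealI)
    show "subgroup ?I (add_monoid ?S)"
    proof (rule S.add.subgroupI)
      show "?I \<subseteq> carrier ?S" by blast
      show "?I \<noteq> {}" using S.zero_closed by (auto simp: pseries_ring_simps)
      fix f g assume f: "f \<in> ?I" and g: "g \<in> ?I"
      show "\<ominus>\<^bsub>?S\<^esub> f \<in> ?I"
        using f S.a_inv_closed[of f] by (auto simp: pseries_ring_uminus)
      have "P m" if "f m + g m \<noteq> 0" for m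
        using f g that by (cases "f m = 0") auto
      then show "f \<oplus>\<^bsub>?S\<^esub> g \<in> ?I"
        using f g S.a_closed[of f g] by (auto simp: pseries_ring_simps)
    qed
    fix f g assume f: "f \<in> ?I" and g: "g \<in> carrier ?S"
    have "P m" if "mcoeff (Mps f * Mps g) m \<noteq> 0" for m
      using that f up by (auto elim!: mcoeff_mult_nonzero)
    then show "f \<otimes>\<^bsub>?S\<^esub> g \<in> ?I"
      using f g S.m_closed[of f g] by (auto simp: pseries_ring_simps)
    then show "g \<otimes>\<^bsub>?S\<^esub> f \<in> ?I" using f g S.m_comm by auto
  qed (rule S.ring_axioms)
qed

lemma finprod_pseries_var:
  assumes "finite F" "F \<subseteq> V"
  shows "(\<Otimes>\<^bsub>pseries_ring V\<^esub> i\<in>F. pseries_var i) = (pseries_monom (expo_on F (\<lambda>_. Suc 0)) :: expo \<Rightarrow> 'k::comm_ring_1)"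
  using assms
proof (induction F rule: finite_induct)
  case empty
  interpret S: cring "pseries_ring V :: (expo \<Rightarrow> 'k) ring" by (rule pseries_ring_cring)
  have "expo_on {} (\<lambda>_. Suc 0) = 0" by (rule expo_eqI) simp
  then have "(pseries_monom (expo_on {} (\<lambda>_. Suc 0)) :: expo \<Rightarrow> 'k) = \<one>\<^bsub>pseries_ring V\<^esub>"
    by (simp add: pseries_ring_def pseries_monom_def)
  then show ?case by simp
next
  case (insert i F)
  interpret S: cring "pseries_ring V :: (expo \<Rightarrow> 'k) ring" by (rule pseries_ring_cring)
  have "Poly_Mapping.single i (Suc 0) + expo_on F (\<lambda>_. Suc 0) = expo_on (insert i F) (\<lambda>_. Suc 0)"
    using insert.hyps by (intro expo_eqI) (auto simp: lookup_add lookup_single when_def)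
  moreover have "(pseries_var j :: expo \<Rightarrow> 'k) \<in> carrier (pseries_ring V)" if "j \<in> insert i F" for j
    using that insert.prems by (auto simp: pseries_var_def pseries_monom_carrier)
  then have "(\<Otimes>\<^bsub>pseries_ring V\<^esub> j\<in>insert i F. pseries_var j) =
      pseries_var i \<otimes>\<^bsub>pseries_ring V\<^esub> (pseries_monom (expo_on F (\<lambda>_. Suc 0)) :: expo \<Rightarrow> 'k)"
    using insert by (subst S.finprod_insert) auto
  ultimately show ?case by (simp add: pseries_var_def pseries_monom_mult)
qed

text \<open>Sorting the monomials of \<open>f\<close> by support gives finitely many parts, each a
  multiple of one squarefree generator, so no infinite sum arises.\<close>

lemma stanley_reisner_ideal_eq:
  assumes "simplicial_complex_on n \<Delta>"
  shows "stanley_reisner_ideal n \<Delta> =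
    {f \<in> carrier (pseries_ring {1..n}). \<forall>m. f m \<noteq> (0::'k::comm_ring_1) \<longrightarrow> supp m \<notin> \<Delta>}"
proof -
  define V where "V = {1..n}"
  have finite_V: "finite V" by (simp add: V_def)
  let ?S = "pseries_ring V :: (expo \<Rightarrow> 'k) ring"
  interpret S: cring ?S by (rule pseries_ring_cring)
  let ?G = "{\<Otimes>\<^bsub>?S\<^esub> i\<in>F. pseries_var i | F. F \<subseteq> V \<and> F \<notin> \<Delta>}"
  have G: "?G = (\<lambda>F. pseries_monom (expo_on F (\<lambda>_. Suc 0))) ` {F. F \<subseteq> V \<and> F \<notin> \<Delta>}"
    using finprod_pseries_var[of _ V] finite_subset[OF _ finite_V]
    by (auto simp: image_iff) metis
  have supp_F: "supp (expo_on F (\<lambda>_. Suc 0)) = F" if "F \<subseteq> V" for F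
    using that finite_subset[OF _ finite_V] by (auto simp: supp_expo_on)
  have G_carrier: "?G \<subseteq> carrier ?S"
    unfolding G by (auto simp: pseries_monom_carrier supp_F)
  interpret J: ideal "Idl\<^bsub>?S\<^esub> ?G" ?S by (rule S.genideal_ideal[OF G_carrier])
  let ?I = "{f \<in> carrier ?S. \<forall>m. f m \<noteq> 0 \<longrightarrow> supp m \<notin> \<Delta>}"
  have "ideal ?I ?S"
    using assms by (intro pseries_monomial_ideal) (auto simp: keys_add_nat simplicial_complex_on_def)
  moreover have "?G \<subseteq> ?I"
    unfolding G by (auto simp: pseries_monom_carrier supp_F pseries_monom_nonzero)
  ultimately have "Idl\<^bsub>?S\<^esub> ?G \<subseteq> ?I" by (rule S.genideal_minimal)
  moreover have "f \<in> Idl\<^bsub>?S\<^esub> ?G"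
    if "finite \<A>" "\<A> \<subseteq> {F. F \<subseteq> V \<and> F \<notin> \<Delta>}" "f \<in> carrier ?S" "\<And>m. f m \<noteq> 0 \<Longrightarrow> supp m \<in> \<A>" for \<A> f
    using that
  proof (induction \<A> arbitrary: f rule: finite_induct)
    case empty
    then have "f = \<zero>\<^bsub>?S\<^esub>" by (auto simp: pseries_ring_simps)
    then show ?case by simp
  next
    case (insert F \<A>)
    let ?k = "expo_on F (\<lambda>_. Suc 0)"
    have F: "F \<subseteq> V" "F \<notin> \<Delta>" "finite F" using insert.prems(1) finite_subset[OF _ finite_V] by auto
    \<comment> \<open>The part of \<open>f\<close> with support exactly \<open>F\<close>;
      \<open>g'\<close> is its quotient by the squarefree monomial of \<open>F\<close>.\<close>
    define g where "g m = (if supp m = F then f m else 0)" for m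
    define h where "h m = (if supp m = F then 0 else f m)" for m
    define g' where "g' m = g (?k + m)" for m
    have "g' \<in> carrier ?S"
      using F(1) by (auto simp: pseries_ring_carrier g'_def g_def keys_add_nat split: if_splits)
    moreover have "pseries_monom ?k \<in> Idl\<^bsub>?S\<^esub> ?G"
      using S.genideal_self[OF G_carrier] F unfolding G by blast
    ultimately have "pseries_monom ?k \<otimes>\<^bsub>?S\<^esub> g' \<in> Idl\<^bsub>?S\<^esub> ?G" by (intro J.I_r_closed)
    moreover have "pseries_monom ?k \<otimes>\<^bsub>?S\<^esub> g' = g"
    proof
      fix m
      show "(pseries_monom ?k \<otimes>\<^bsub>?S\<^esub> g') m = g m"
      proof (cases "\<exists>l. m = ?k + l")
        case True
        then show ?thesis by (auto simp: pseries_ring_simps g'_def)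
      next
        case False
        then have "\<not> (\<forall>i. expo_at ?k i \<le> expo_at m i)" using expo_splitI by blast
        then have "supp m \<noteq> F" using F(3) by (auto simp: in_keys_iff split: if_splits)
        with False show ?thesis by (simp add: pseries_ring_simps mcoeff_mmonom_mult_eq_0 g_def)
      qed
    qed
    moreover have "h \<in> Idl\<^bsub>?S\<^esub> ?G"
    proof (rule insert.IH)
      show "\<A> \<subseteq> {F. F \<subseteq> V \<and> F \<notin> \<Delta>}" using insert.prems(1) by blast
      show "h \<in> carrier ?S" using insert.prems(2) by (auto simp: pseries_ring_carrier h_def)
      show "supp m \<in> \<A>" if "h m \<noteq> 0" for m
        using insert.prems(3)[of m] that by (auto simp: h_def split: if_splits)
    qed
    ultimately have "g \<oplus>\<^bsub>?S\<^esub> h \<in> Idl\<^bsub>?S\<^esub> ?G" by simp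
    moreover have "g \<oplus>\<^bsub>?S\<^esub> h = f" by (auto simp: pseries_ring_simps g_def h_def)
    ultimately show ?case by simp
  qed
  from this[of "{F. F \<subseteq> V \<and> F \<notin> \<Delta>}"] have "?I \<subseteq> Idl\<^bsub>?S\<^esub> ?G"
    using finite_V by (auto simp: pseries_ring_carrier)
  ultimately show ?thesis unfolding stanley_reisner_ideal_def V_def by (rule equalityI)
qed

text \<open>For the support \<open>N\<close> of \<open>u\<close>: if \<open>N - {i}\<close> were a nonface, another generator would divide \<open>u\<close>.\<close>

lemma minimal_generator_link:
  assumes "simplicial_complex_on n \<Delta>"
    and "minimal_monomial_generator (pseries_ring {1..n}) (stanley_reisner_ideal n \<Delta>) (u :: expo \<Rightarrow> 'k::comm_ring_1)"
    and "pseries_var i divides\<^bsub>pseries_ring {1..n}\<^esub> u"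
  shows "\<exists>N\<subseteq>{1..n}. N \<notin> \<Delta> \<and> i \<in> N \<and> N - {i} \<in> \<Delta>"
proof -
  define V where "V = {1..n}"
  let ?I = "stanley_reisner_ideal n \<Delta> :: (expo \<Rightarrow> 'k) set"
  let ?S = "pseries_ring V :: (expo \<Rightarrow> 'k) ring"
  interpret S: cring ?S by (rule pseries_ring_cring)
  note I_eq = stanley_reisner_ideal_eq[OF assms(1), where 'k = 'k, folded V_def]
  note u_min = assms(2)[folded V_def] and dvd = assms(3)[folded V_def]
  from u_min obtain G where G: "G \<subseteq> carrier ?S" "G \<subseteq> range pseries_monom" "Idl\<^bsub>?S\<^esub> G = ?I"
    and min: "\<And>H. H \<subset> G \<Longrightarrow> Idl\<^bsub>?S\<^esub> H \<noteq> ?I" and u: "u \<in> G"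
    by (auto simp: minimal_monomial_generator_def minimal_monomial_generators_def)
  obtain m where m: "u = pseries_monom m" using G(2) u by auto
  have "pseries_monom m \<in> carrier ?S" using G(1) u m by blast
  then have m_V: "supp m \<subseteq> V" by (simp only: pseries_monom_carrier)
  have "u m \<noteq> 0" by (simp add: m pseries_monom_def)
  from dvd obtain c where "u = pseries_var i \<otimes>\<^bsub>?S\<^esub> c" by (auto simp: factor_def)
  with \<open>u m \<noteq> 0\<close> obtain b where "m = Poly_Mapping.single i 1 + b"
    by (auto simp: pseries_ring_simps pseries_var_def mcoeff_mmonom elim!: mcoeff_mult_nonzero split: if_splits)
  then have i: "i \<in> supp m" by (simp add: in_keys_iff lookup_add)
  have "u \<in> ?I" using S.genideal_self[OF G(1)] u G(3) by auto
  then have m_face: "supp m \<notin> \<Delta>" using \<open>u m \<noteq> 0\<close> unfolding I_eq by blast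
  have "supp m - {i} \<in> \<Delta>"
  proof (rule ccontr)
    assume nonface: "supp m - {i} \<notin> \<Delta>"
    \<comment> \<open>Dropping \<open>x_i\<close> altogether keeps the monomial in the ideal, so a
      generator other than \<open>u\<close> divides it and hence \<open>u\<close>, making
      \<open>u\<close> redundant.\<close>
    define m' where "m' = expo_on (supp m - {i}) (expo_at m)"
    have m'_at: "expo_at m' j = (if j = i then 0 else expo_at m j)" for j
      by (auto simp: m'_def in_keys_iff)
    have supp_m': "supp m' = supp m - {i}" by (auto simp: in_keys_iff m'_at split: if_splits)
    have "pseries_monom m' \<in> ?I"
      unfolding I_eq using nonface m_V supp_m'
      by (auto simp: pseries_monom_carrier) (simp add: pseries_monom_def split: if_splits)
    then have "pseries_monom m' \<in> Idl\<^bsub>?S\<^esub> G" by (simp add: G(3))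
    moreover let ?P = "\<lambda>k. \<exists>l r. pseries_monom l \<in> G \<and> k = l + r"
    have "Idl\<^bsub>?S\<^esub> G \<subseteq> {f \<in> carrier ?S. \<forall>k. f k \<noteq> 0 \<longrightarrow> ?P k}"
    proof (rule S.genideal_minimal)
      show "ideal {f \<in> carrier ?S. \<forall>k. f k \<noteq> 0 \<longrightarrow> ?P k} ?S"
        by (rule pseries_monomial_ideal) (metis add.assoc)
      have "?P k" if f: "f \<in> G" and k: "f k \<noteq> 0" for f k
      proof -
        obtain l where l: "f = pseries_monom l" using f G(2) by auto
        with k have "k = l + 0" by (simp add: pseries_monom_nonzero)
        with f l show ?thesis by blast
      qed
      then show "G \<subseteq> {f \<in> carrier ?S. \<forall>k. f k \<noteq> 0 \<longrightarrow> ?P k}" using G(1) by blast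
    qed
    moreover have "(pseries_monom m' :: expo \<Rightarrow> 'k) m' \<noteq> 0" by (simp add: pseries_monom_nonzero)
    ultimately obtain l r where l: "pseries_monom l \<in> G" "m' = l + r" by blast
    have l_at: "expo_at l j \<le> expo_at m' j" for j by (simp add: l(2) lookup_add)
    have "expo_at l j \<le> expo_at m j" for j
      using l_at[of j] by (auto simp: m'_at split: if_splits)
    then obtain r' where r': "m = l + r'" using expo_splitI by blast
    have "expo_at l i = 0" using l_at[of i] by (simp add: m'_at)
    then have "l \<noteq> m" using i by (auto simp: in_keys_iff)
    let ?H = "G - {u}"
    have H: "?H \<subseteq> carrier ?S" using G(1) by blast
    interpret H: ideal "Idl\<^bsub>?S\<^esub> ?H" ?S by (rule S.genideal_ideal[OF H])
    have "pseries_monom l \<in> Idl\<^bsub>?S\<^esub> ?H"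
      using S.genideal_self[OF H] l(1) \<open>l \<noteq> m\<close> by (auto simp: m pseries_monom_inject)
    moreover have "pseries_monom r' \<in> carrier ?S"
      using m_V by (auto simp: pseries_monom_carrier r' keys_add_nat)
    ultimately have "pseries_monom l \<otimes>\<^bsub>?S\<^esub> pseries_monom r' \<in> Idl\<^bsub>?S\<^esub> ?H" by (rule H.I_r_closed)
    then have "u \<in> Idl\<^bsub>?S\<^esub> ?H" by (simp add: pseries_monom_mult m r')
    then have "G \<subseteq> Idl\<^bsub>?S\<^esub> ?H" using S.genideal_self[OF H] by blast
    then have "Idl\<^bsub>?S\<^esub> G \<subseteq> Idl\<^bsub>?S\<^esub> ?H" by (rule S.genideal_minimal[OF H.is_ideal])
    moreover have "Idl\<^bsub>?S\<^esub> ?H \<subseteq> Idl\<^bsub>?S\<^esub> G" by (rule S.subset_Idl_subset[OF G(1)]) blast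
    ultimately show False using min[of ?H] u G(3) by blast
  qed
  with m_V m_face i show ?thesis unfolding V_def by blast
qed

text \<open>Sets the variables outside \<open>V\<close> to zero. This is a ring homomorphism because
  the support of a product of monomials is the union of their supports.\<close>

definition restrict_vars :: "nat set \<Rightarrow> 'k::zero mps \<Rightarrow> expo \<Rightarrow> 'k" where
  "restrict_vars V f = (\<lambda>m. if supp m \<subseteq> V then mcoeff f m else 0)"

lemma restrict_vars_carrier: "restrict_vars V f \<in> carrier (pseries_ring V)"
  by (simp add: pseries_ring_carrier restrict_vars_def)

lemma restrict_vars_id: "f \<in> carrier (pseries_ring V) \<Longrightarrow> restrict_vars V (Mps f) = f"
  by (intro ext) (auto simp: pseries_ring_carrier restrict_vars_def)

lemma restrict_vars_add:
  "restrict_vars V (f + g) = restrict_vars V f \<oplus>\<^bsub>pseries_ring V\<^esub> restrict_vars V g"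
  by (auto simp: pseries_ring_simps restrict_vars_def)

lemma restrict_vars_mult:
  "restrict_vars V (f * g) = restrict_vars V f \<otimes>\<^bsub>pseries_ring V\<^esub> restrict_vars V g"
proof
  fix m
  have "(restrict_vars V f \<otimes>\<^bsub>pseries_ring V\<^esub> restrict_vars V g) m =
      (\<Sum>(a, b) | a + b = m. if supp m \<subseteq> V then mcoeff f a * mcoeff g b else 0)"
    unfolding pseries_ring_simps mcoeff_mult mcoeff_Mps restrict_vars_def
    by (rule sum.cong) (auto simp: keys_add_nat)
  then show "restrict_vars V (f * g) m = (restrict_vars V f \<otimes>\<^bsub>pseries_ring V\<^esub> restrict_vars V g) m"
    by (auto simp: mcoeff_mult case_prod_unfold restrict_vars_def)
qed

lemma restrict_vars_1: "restrict_vars V 1 = \<one>\<^bsub>pseries_ring V\<^esub>"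
  by (auto simp: pseries_ring_simps restrict_vars_def)

text \<open>Setting the variables outside \<open>{1..n}\<close> to zero does not disturb the
  description of the kernel: a monomial involving one of them has nonface support.\<close>

lemma stanley_reisner_face_ring:
  fixes \<tau> :: "'k::field \<Rightarrow> 'k"
  assumes "frobenius_trace p \<tau> {1..n}" and complex: "simplicial_complex_on n \<Delta>"
  defines "S \<equiv> pseries_ring {1..n}" and "I \<equiv> stanley_reisner_ideal n \<Delta>"
  shows "face_ring p \<tau> {1..n} (S Quot I) \<Delta> (\<lambda>f. I +>\<^bsub>S\<^esub> restrict_vars {1..n} f)"
proof -
  let ?r = "restrict_vars {1..n} :: 'k mps \<Rightarrow> expo \<Rightarrow> 'k"
  interpret frobenius_trace p \<tau> "{1..n}" by fact
  interpret S: cring S unfolding S_def by (rule pseries_ring_cring)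
  note I_eq = stanley_reisner_ideal_eq[OF complex, where 'k = 'k, folded S_def I_def]
  interpret I: ideal I S
    unfolding I_eq unfolding S_def using complex
    by (intro pseries_monomial_ideal) (auto simp: keys_add_nat simplicial_complex_on_def)
  interpret R: cring "S Quot I" by (rule I.quotient_is_cring) (rule S.is_cring)
  note hom = I.rcos_ring_hom
  note r = restrict_vars_carrier[of "{1..n}", where 'a = 'k, folded S_def]
  show ?thesis
  proof unfold_locales
    show "G \<in> \<Delta>" if "F \<in> \<Delta>" "G \<subseteq> F" for F G
      using complex that by (auto simp: simplicial_complex_on_def)
    show faces: "F \<subseteq> {1..n}" if "F \<in> \<Delta>" for F
      using complex that by (auto simp: simplicial_complex_on_def)
    show "range (\<lambda>f. I +>\<^bsub>S\<^esub> ?r f) = carrier (S Quot I)"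
    proof
      show "range (\<lambda>f. I +>\<^bsub>S\<^esub> ?r f) \<subseteq> carrier (S Quot I)"
        using ring_hom_closed[OF hom r] by blast
      show "carrier (S Quot I) \<subseteq> range (\<lambda>f. I +>\<^bsub>S\<^esub> ?r f)"
      proof
        fix x assume "x \<in> carrier (S Quot I)"
        then obtain f where f: "f \<in> carrier S" "x = I +>\<^bsub>S\<^esub> f"
          by (auto simp: FactRing_def A_RCOSETS_def')
        then have "?r (Mps f) = f" unfolding S_def by (intro restrict_vars_id)
        with f(2) show "x \<in> range (\<lambda>f. I +>\<^bsub>S\<^esub> ?r f)" by (metis rangeI)
      qed
    qed
    show "I +>\<^bsub>S\<^esub> ?r (f + g) = (I +>\<^bsub>S\<^esub> ?r f) \<oplus>\<^bsub>S Quot I\<^esub> (I +>\<^bsub>S\<^esub> ?r g)" for f g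
      using ring_hom_add[OF hom r r, of f g] by (simp only: restrict_vars_add S_def)
    show "I +>\<^bsub>S\<^esub> ?r (f * g) = (I +>\<^bsub>S\<^esub> ?r f) \<otimes>\<^bsub>S Quot I\<^esub> (I +>\<^bsub>S\<^esub> ?r g)" for f g
      using ring_hom_mult[OF hom r r, of f g] by (simp only: restrict_vars_mult S_def)
    show "I +>\<^bsub>S\<^esub> ?r 1 = \<one>\<^bsub>S Quot I\<^esub>"
      using ring_hom_one[OF hom] by (simp only: restrict_vars_1 S_def)
    show "I +>\<^bsub>S\<^esub> ?r f = \<zero>\<^bsub>S Quot I\<^esub> \<longleftrightarrow> (\<forall>m. mcoeff f m \<noteq> 0 \<longrightarrow> supp m \<notin> \<Delta>)" for f
    proof -
      have "I +>\<^bsub>S\<^esub> ?r f = \<zero>\<^bsub>S Quot I\<^esub> \<longleftrightarrow> I +>\<^bsub>S\<^esub> ?r f = I" by (simp only: FactRing_def ring.simps)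
      also have "\<dots> \<longleftrightarrow> ?r f \<in> I"
        using S.a_rcos_zero[OF I.is_ideal] I.rcos_const_imp_mem[OF r] by blast
      also have "\<dots> \<longleftrightarrow> (\<forall>m. ?r f m \<noteq> 0 \<longrightarrow> supp m \<notin> \<Delta>)" unfolding I_eq using r by blast
      also have "\<dots> \<longleftrightarrow> (\<forall>m. mcoeff f m \<noteq> 0 \<longrightarrow> supp m \<notin> \<Delta>)"
        using faces unfolding restrict_vars_def by metis
      finally show ?thesis .
    qed
  qed
qed

theorem theorem4:
  fixes n p :: nat
    and \<Delta> :: "nat set set"
    and S :: "((nat \<Rightarrow>\<^sub>0 nat) \<Rightarrow> 'k::field) ring"
    and I :: "((nat \<Rightarrow>\<^sub>0 nat) \<Rightarrow> 'k) set"
    and R :: "((nat \<Rightarrow>\<^sub>0 nat) \<Rightarrow> 'k) set ring"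
  assumes "CHAR('k) = p" and "p > 0"
    and "F_finite TYPE('k)"
    and "simplicial_complex_on n \<Delta>"
    and "S = pseries_ring {1..n}"
    and "I = stanley_reisner_ideal n \<Delta>"
    and "R = S Quot I"
    and "\<forall>i\<in>{1..n}. \<exists>u. minimal_monomial_generator S I u \<and> pseries_var i divides\<^bsub>S\<^esub> u"
  shows "cartier_principally_generated p R \<longleftrightarrow> \<not> (\<exists>F. free_face \<Delta> F)"
proof -
  obtain \<tau> :: "'k \<Rightarrow> 'k" where \<tau>:
    "\<And>u v. \<tau> (u + v) = \<tau> u + \<tau> v" "\<And>c u. \<tau> (c ^ p * u) = c * \<tau> u"
    "\<exists>J :: nat set. \<exists>y z. finite J \<and> (\<forall>x. x = (\<Sum>j\<in>J. \<tau> (x * y j) ^ p * z j))"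
    by (rule frobenius_trace_exists[OF assms(1-3)]) (rule that)
  have trace: "frobenius_trace p \<tau> {1..n}"
    by unfold_locales (use assms(1,2) \<tau> in auto)
  interpret face_ring p \<tau> "{1..n}" R \<Delta>
    "\<lambda>f. I +>\<^bsub>S\<^esub> restrict_vars {1..n} f"
    unfolding assms(5-7) by (rule stanley_reisner_face_ring[OF trace assms(4)])
  have "\<exists>N\<subseteq>{1..n}. N \<notin> \<Delta> \<and> i \<in> N \<and> N - {i} \<in> \<Delta>" if "i \<in> {1..n}" for i
    using assms(8) that minimal_generator_link[OF assms(4)] unfolding assms(5,6) by blast
  then show ?thesis
    using principally_generated_if_no_free_face no_free_face_if_principally_generated by blast
qed

end
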